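(* Let $G$ be a finite-dimensional Lie group with Lie algebra $\mathfrak g$, $\tau:\mathfrak g\to G$ a retraction map, $h,h_1,\dots,h_N:G\times\mathfrak g^*\to\mathbb R$ smooth, $\Delta t>0$, $M\ge1$ the number of time steps, and $\Delta W^i_k$ ($i=1,\dots,N$, $k=1,\dots,M$) the increments over the $k$-th time step of independent Wiener processes. For discrete curves $$c_d=(g_0,\tilde g_1,\tilde\mu^1_1,\tilde\mu^2_1,g_1,\dots,g_{M-1},\tilde g_M,\tilde\mu^1_M,\tilde\mu^2_M,g_M)\in G\times\big(G\times(\mathfrak g^*\oplus\mathfrak g^* )\times G\big)^M$$ let $$\mathcal G_d(c_d)=\sum_{k=0}^{M-1}\Delta t\Big[\Big\langle\tilde\mu^2_{k+1},\tfrac{\tau^{-1}(\tilde g_{k+1}^{-1}g_{k+1})}{\Delta t}\Big\rangle+\Big\langle\tilde\mu^1_{k+1},\tfrac{\tau^{-1}(g_k^{-1}\tilde g_{k+1})}{\Delta t}\Big\rangle-h\Big(\tilde g_{k+1},\tfrac{\tilde\mu^1_{k+1}+\tilde\mu^2_{k+1}}2\Big)-\sum_{i=1}^N h_i\Big(\tilde g_{k+1},\tfrac{\tilde\mu^1_{k+1}+\tilde\mu^2_{k+1}}2\Big)\tfrac{\Delta W^i_{k+1}}{\Delta t}\Big].$$ Then the discrete variational principle $\mathrm d\mathcal G_d(c_d)\cdot\delta c_d=0$ for all variations with $\delta g_0=0$ and $\delta g_M=0$ yields, as its critical point equations, the following stochastic midpoint Lie group method, where $\Delta t\,\xi_k:=\tau^{-1}(\tilde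 g_k^{-1}g_k)$, $\Delta t\,\tilde\xi_k:=\tau^{-1}(g_{k-1}^{-1}\tilde g_k)$, and all derivatives of $h,h_i$ are evaluated at $\big(\tilde g_k,\tfrac{\tilde\mu^1_k+\tilde\mu^2_k}2\big)$: $$\frac1{\Delta t}\Big(\mathrm{Ad}^*_{\tau(\Delta t\tilde\xi_k)}[\mathrm d_{\Delta t\tilde\xi_k}\tau^{-1}]^*\tilde\mu^1_k-[\mathrm d_{\Delta t\xi_k}\tau^{-1}]^*\tilde\mu^2_k\Big)=\tilde g_k^{-1}\frac{\partial h}{\partial g}+\sum_{i=1}^N\tilde g_k^{-1}\frac{\partial h_i}{\partial g}\frac{\Delta W^i_k}{\Delta t},\quad k=1,\dots,M,$$ $$\frac1{\Delta t}\Big(\mathrm{Ad}^*_{\tau(\Delta t\xi_k)}[\mathrm d_{\Delta t\xi_k}\tau^{-1}]^*\tilde\mu^2_k-[\mathrm d_{\Delta t\tilde\xi_{k+1}}\tau^{-1}]^*\tilde\mu^1_{k+1}\Big)=0,\quad k=1,\dots,M-1,$$ $$\tilde\xi_k=\frac12\frac{\partial h}{\partial\mu}+\frac12\sum_{i=1}^N\frac{\partial h_i}{\partial\mu}\frac{\Delta W_k^i}{\Delta t},\qquad \xi_k=\frac12\frac{\partial h}{\partial\mu}+\frac12\sum_{i=1}^N\frac{\partial h_i}{\partial\mu}\frac{\Delta W_k^i}{\Delta t},\quad k=1,\dots,M.$$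
   Context: A retraction map $\tau:\mathfrak g\to G$ is a local diffeomorphism (near $0$) with $\tau(0)=e$; all the group elements $\tilde g_k^{-1}g_k$ and $g_{k-1}^{-1}\tilde g_k$ are assumed to lie in the neighbourhood of $e$ where $\tau^{-1}$ is defined and smooth. The right-trivialized derivative of $\tau^{-1}$ is $\mathrm d_\xi\tau^{-1}(\eta):=\mathrm D\tau^{-1}(g)\cdot(\eta g)\in\mathfrak g$ for $\xi,\eta\in\mathfrak g$, $g=\tau(\xi)$, where $\eta g$ is the right translate of $\eta$ to $T_gG$; $[\mathrm d_\xi\tau^{-1}]^*:\mathfrak g^*\to\mathfrak g^*$ is its dual map. The coadjoint operator is $\langle\mathrm{Ad}^*_g\mu,\eta\rangle=\langle\mu,\mathrm{Ad}_g\eta\rangle$. For $\alpha\in T_g^*G$, $g^{-1}\alpha\in\mathfrak g^*$ denotes left translation: $\langle g^{-1}\alpha,\eta\rangle=\langle\alpha,g\eta\rangle$. $\partial h/\partial g\in T_g^*G$ and $\partial h/\partial\mu\in\mathfrak g$ are the partial derivatives. Statements are pathwise, for a fixed realization of the increments. *)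

theory Defs
  imports "HOL-Probability.Probability" "HOL-Algebra.Group"
begin

text \<open>
  All normed spaces below are meant to be finite-dimensional. The model space of a manifold is
  a type of class \<open>real_inner\<close> that is spanned by a finite set, and not of class
  \<open>euclidean_space\<close>, since the latter class has no zero-dimensional instance. The inner product
  is never used in a definition.
\<close>


subsection \<open>Smooth maps and manifolds\<close>

text \<open>
  \<open>C_k_on k f S\<close> is used for open \<open>S\<close> only. On a finite-dimensional domain, \<open>f\<close> is of class
  C^(k+1) iff it is differentiable and all its directional derivatives are of class C^k.
\<close>

primrec C_k_on ::
  "nat \<Rightarrow> ('a::real_normed_vector \<Rightarrow> 'b::real_normed_vector) \<Rightarrow> 'a set \<Rightarrow> bool"
where
  "C_k_on 0 f S \<longleftrightarrow> continuous_on S f"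
| "C_k_on (Suc k) f S \<longleftrightarrow>
     (\<forall>x\<in>S. f differentiable (at x)) \<and>
     (\<forall>v. C_k_on k (\<lambda>x. frechet_derivative f (at x) v) S)"

definition smooth_on ::
  "('a::real_normed_vector \<Rightarrow> 'b::real_normed_vector) \<Rightarrow> 'a set \<Rightarrow> bool"
where
  "smooth_on f S \<longleftrightarrow> (\<forall>k. C_k_on k f S)"

text \<open>A chart is a pair of its domain and its coordinate map.\<close>

type_synonym ('p, 'e) chart = "'p set \<times> ('p \<Rightarrow> 'e)"
type_synonym ('p, 'e) atlas = "('p, 'e) chart set"

definition smooth_atlas ::
  "('p::topological_space, 'e::real_normed_vector) atlas \<Rightarrow> bool"
where
  "smooth_atlas A \<longleftrightarrow>
     (\<Union>(U, \<phi>)\<in>A. U) = UNIV \<and>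
     (\<forall>(U, \<phi>)\<in>A. open U \<and> open (\<phi> ` U) \<and> homeomorphism U (\<phi> ` U) \<phi> (inv_into U \<phi>)) \<and>
     (\<forall>(U, \<phi>)\<in>A. \<forall>(V, \<psi>)\<in>A. smooth_on (\<psi> \<circ> inv_into U \<phi>) (\<phi> ` (U \<inter> V)))"

definition vec_atlas :: "('v, 'v) atlas" where
  "vec_atlas = {(UNIV, id)}"

definition prod_atlas ::
  "('p, 'e) atlas \<Rightarrow> ('q, 'f) atlas \<Rightarrow> ('p \<times> 'q, 'e \<times> 'f) atlas"
where
  "prod_atlas A B = {(U \<times> V, map_prod \<phi> \<psi>) | U \<phi> V \<psi>. (U, \<phi>) \<in> A \<and> (V, \<psi>) \<in> B}"

text \<open>Smoothness of a map on an open subset \<open>S\<close> of a manifold.\<close>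

definition smooth_map_on ::
  "('p::topological_space, 'e::real_normed_vector) atlas \<Rightarrow>
   ('q::topological_space, 'f::real_normed_vector) atlas \<Rightarrow> 'p set \<Rightarrow> ('p \<Rightarrow> 'q) \<Rightarrow> bool"
where
  "smooth_map_on A B S f \<longleftrightarrow>
     continuous_on S f \<and>
     (\<forall>(U, \<phi>)\<in>A. \<forall>(V, \<psi>)\<in>B.
        smooth_on (\<psi> \<circ> f \<circ> inv_into U \<phi>) (\<phi> ` (U \<inter> S \<inter> f -` V)))"


subsection \<open>Tangent vectors\<close>

text \<open>
  Each point \<open>p\<close> is given a preferred chart. The tangent space at \<open>p\<close> is represented by the
  model space: a tangent vector is its coordinate vector with respect to the preferred chart
  at \<open>p\<close>. The cotangent space at \<open>p\<close> is accordingly the dual of the model space. For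
  \<^const>\<open>vec_atlas\<close> this is the usual identification of the tangent spaces of a vector space
  with the space itself.
\<close>

type_synonym 'e dual = "'e \<Rightarrow>\<^sub>L real"

definition chart_at :: "('p, 'e) atlas \<Rightarrow> 'p \<Rightarrow> ('p, 'e) chart" where
  "chart_at A p = (SOME c. c \<in> A \<and> p \<in> fst c)"

definition tangent_map ::
  "('p, 'e::real_normed_vector) atlas \<Rightarrow> ('q, 'f::real_normed_vector) atlas \<Rightarrow>
   ('p \<Rightarrow> 'q) \<Rightarrow> 'p \<Rightarrow> 'e \<Rightarrow>\<^sub>L 'f"
where
  "tangent_map A B f p =
     (let (U, \<phi>) = chart_at A p; (V, \<psi>) = chart_at B (f p)
      in Blinfun (frechet_derivative (\<psi> \<circ> f \<circ> inv_into U \<phi>) (at (\<phi> p))))"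

text \<open>\<open>\<gamma>\<close> is a curve, smooth near time 0, through \<open>p\<close> with velocity \<open>v\<close> at time 0.\<close>

definition tangent_curve ::
  "('p::topological_space, 'e::real_normed_vector) atlas \<Rightarrow> (real \<Rightarrow> 'p) \<Rightarrow> 'p \<Rightarrow> 'e \<Rightarrow> bool"
where
  "tangent_curve A \<gamma> p v \<longleftrightarrow>
     \<gamma> 0 = p \<and>
     (\<exists>r>0. smooth_map_on vec_atlas A {-r<..<r} \<gamma>) \<and>
     ((snd (chart_at A p) \<circ> \<gamma>) has_vector_derivative v) (at 0)"


subsection \<open>Lie groups\<close>

text \<open>
  The model space \<open>'e\<close> is also the tangent space at the identity, i.e. the Lie algebra.
\<close>

locale lie_group = group G
  for G :: "'g::{t2_space, second_countable_topology} monoid" (structure)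
  and A :: "('g, 'e::real_inner) atlas" +
  assumes carrier_UNIV: "carrier G = UNIV"
    and finite_dim: "\<exists>B::'e set. finite B \<and> span B = UNIV"
    and atlas: "smooth_atlas A"
    and smooth_mult: "smooth_map_on (prod_atlas A A) A UNIV (\<lambda>(x, y). x \<otimes> y)"
    and smooth_inv: "smooth_map_on A A UNIV (\<lambda>x. inv x)"

text \<open>\<open>left_trans G A g \<eta>\<close> and \<open>right_trans G A g \<eta>\<close> are \<open>g\<eta>\<close> and \<open>\<eta>g\<close> in the tangent space at \<open>g\<close>.\<close>

definition left_trans ::
  "'g monoid \<Rightarrow> ('g, 'e::real_normed_vector) atlas \<Rightarrow> 'g \<Rightarrow> 'e \<Rightarrow>\<^sub>L 'e"
where
  "left_trans G A g = tangent_map A A (\<lambda>x. g \<otimes>\<^bsub>G\<^esub> x) \<one>\<^bsub>G\<^esub>"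

definition right_trans ::
  "'g monoid \<Rightarrow> ('g, 'e::real_normed_vector) atlas \<Rightarrow> 'g \<Rightarrow> 'e \<Rightarrow>\<^sub>L 'e"
where
  "right_trans G A g = tangent_map A A (\<lambda>x. x \<otimes>\<^bsub>G\<^esub> g) \<one>\<^bsub>G\<^esub>"

definition Ad ::
  "'g monoid \<Rightarrow> ('g, 'e::real_normed_vector) atlas \<Rightarrow> 'g \<Rightarrow> 'e \<Rightarrow>\<^sub>L 'e"
where
  "Ad G A g = tangent_map A A (\<lambda>x. g \<otimes>\<^bsub>G\<^esub> x \<otimes>\<^bsub>G\<^esub> inv\<^bsub>G\<^esub> g) \<one>\<^bsub>G\<^esub>"

definition dual_map ::
  "('e::real_normed_vector \<Rightarrow>\<^sub>L 'f::real_normed_vector) \<Rightarrow> 'f dual \<Rightarrow> 'e dual"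
where
  "dual_map L \<mu> = \<mu> o\<^sub>L L"

definition coAd ::
  "'g monoid \<Rightarrow> ('g, 'e::real_normed_vector) atlas \<Rightarrow> 'g \<Rightarrow> 'e dual \<Rightarrow> 'e dual"
where
  "coAd G A g = dual_map (Ad G A g)"

text \<open>
  For a covector \<open>\<alpha>\<close> at \<open>g\<close>, \<open>left_cotrans G A g \<alpha>\<close> is the left translate of \<open>\<alpha>\<close> by the inverse
  of \<open>g\<close>, a covector at the identity.
\<close>

definition left_cotrans ::
  "'g monoid \<Rightarrow> ('g, 'e::real_normed_vector) atlas \<Rightarrow> 'g \<Rightarrow> 'e dual \<Rightarrow> 'e dual"
where
  "left_cotrans G A g = dual_map (left_trans G A g)"

text \<open>
  \<open>U\<close> is a neighbourhood of 0 which \<open>\<tau>\<close> maps diffeomorphically onto a neighbourhood of the identity.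
\<close>

definition lie_retraction ::
  "'g monoid \<Rightarrow> ('g::topological_space, 'e::real_normed_vector) atlas \<Rightarrow>
   ('e \<Rightarrow> 'g) \<Rightarrow> 'e set \<Rightarrow> bool"
where
  "lie_retraction G A \<tau> U \<longleftrightarrow>
     open U \<and> 0 \<in> U \<and> \<tau> 0 = \<one>\<^bsub>G\<^esub> \<and>
     inj_on \<tau> U \<and> open (\<tau> ` U) \<and>
     smooth_map_on vec_atlas A U \<tau> \<and>
     smooth_map_on A vec_atlas (\<tau> ` U) (inv_into U \<tau>)"

definition d_tau_inv ::
  "'g monoid \<Rightarrow> ('g, 'e::real_normed_vector) atlas \<Rightarrow> ('e \<Rightarrow> 'g) \<Rightarrow> 'e set \<Rightarrow> 'e \<Rightarrow> 'e \<Rightarrow>\<^sub>L 'e"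
where
  "d_tau_inv G A \<tau> U \<xi> =
     tangent_map A vec_atlas (inv_into U \<tau>) (\<tau> \<xi>) o\<^sub>L right_trans G A (\<tau> \<xi>)"

definition partial_group ::
  "('g, 'e::real_normed_vector) atlas \<Rightarrow> ('g \<times> 'e dual \<Rightarrow> real) \<Rightarrow> 'g \<times> 'e dual \<Rightarrow> 'e dual"
where
  "partial_group A h = (\<lambda>(g, \<mu>). tangent_map A vec_atlas (\<lambda>x. h (x, \<mu>)) g)"

text \<open>
  The derivative with respect to the momentum lies in the bidual of the Lie algebra, and is
  represented by the unique element of the Lie algebra that induces it.
\<close>

definition partial_momentum ::
  "('g \<times> 'e::real_normed_vector dual \<Rightarrow> real) \<Rightarrow> 'g \<times> 'e dual \<Rightarrow> 'e"
where
  "partial_momentum h = (\<lambda>(g, \<mu>).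
     THE v. \<forall>\<nu>. frechet_derivative (\<lambda>\<rho>. h (g, \<rho>)) (at \<mu>) \<nu> = blinfun_apply \<nu> v)"


subsection \<open>Discrete curves and the variational principle\<close>

text \<open>
  A discrete curve with \<open>M\<close> steps consists of \<open>node c k\<close> for \<open>k \<le> M\<close> and of \<open>stage c k\<close>,
  \<open>mom1 c k\<close>, \<open>mom2 c k\<close> for \<open>1 \<le> k \<le> M\<close>; all other values are irrelevant. A tangent vector at
  a discrete curve has the same shape, with \<open>'p\<close> replaced by the model space.
\<close>

record ('p, 'd) discrete_curve =
  node :: "nat \<Rightarrow> 'p"
  stage :: "nat \<Rightarrow> 'p"
  mom1 :: "nat \<Rightarrow> 'd"
  mom2 :: "nat \<Rightarrow> 'd"

definition mid_state ::
  "('g, 'e::real_normed_vector dual) discrete_curve \<Rightarrow> nat \<Rightarrow> 'g \<times> 'e dual"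
where
  "mid_state c k = (stage c k, (mom1 c k + mom2 c k) /\<^sub>R 2)"

text \<open>\<open>step_elem1\<close> and \<open>step_elem2\<close> are the group elements to which the inverse of \<open>\<tau>\<close> is applied.\<close>

definition step_elem1 :: "'g monoid \<Rightarrow> ('g, 'd) discrete_curve \<Rightarrow> nat \<Rightarrow> 'g" where
  "step_elem1 G c k = inv\<^bsub>G\<^esub> (node c (k - 1)) \<otimes>\<^bsub>G\<^esub> stage c k"

definition step_elem2 :: "'g monoid \<Rightarrow> ('g, 'd) discrete_curve \<Rightarrow> nat \<Rightarrow> 'g" where
  "step_elem2 G c k = inv\<^bsub>G\<^esub> (stage c k) \<otimes>\<^bsub>G\<^esub> node c k"

definition discrete_action ::
  "'g monoid \<Rightarrow> ('e::real_normed_vector \<Rightarrow> 'g) \<Rightarrow> 'e set \<Rightarrow>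
   ('g \<times> 'e dual \<Rightarrow> real) \<Rightarrow> nat \<Rightarrow> (nat \<Rightarrow> 'g \<times> 'e dual \<Rightarrow> real) \<Rightarrow>
   real \<Rightarrow> nat \<Rightarrow> (nat \<Rightarrow> nat \<Rightarrow> real) \<Rightarrow> ('g, 'e dual) discrete_curve \<Rightarrow> real"
where
  "discrete_action G \<tau> U h N hs \<Delta>t M \<Delta>W c =
     (\<Sum>k<M. \<Delta>t *
        (blinfun_apply (mom2 c (Suc k)) (inv_into U \<tau> (step_elem2 G c (Suc k)) /\<^sub>R \<Delta>t)
         + blinfun_apply (mom1 c (Suc k)) (inv_into U \<tau> (step_elem1 G c (Suc k)) /\<^sub>R \<Delta>t)
         - h (mid_state c (Suc k))
         - (\<Sum>i=1..N. hs i (mid_state c (Suc k)) * (\<Delta>W i (Suc k) / \<Delta>t))))"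

definition variation_curve ::
  "('g::topological_space, 'e::real_normed_vector) atlas \<Rightarrow> nat \<Rightarrow>
   (real \<Rightarrow> ('g, 'e dual) discrete_curve) \<Rightarrow>
   ('g, 'e dual) discrete_curve \<Rightarrow> ('e, 'e dual) discrete_curve \<Rightarrow> bool"
where
  "variation_curve A M \<gamma> c \<delta> \<longleftrightarrow>
     (\<forall>k\<in>{0..M}. tangent_curve A (\<lambda>\<epsilon>. node (\<gamma> \<epsilon>) k) (node c k) (node \<delta> k)) \<and>
     (\<forall>k\<in>{1..M}. tangent_curve A (\<lambda>\<epsilon>. stage (\<gamma> \<epsilon>) k) (stage c k) (stage \<delta> k) \<and>
        tangent_curve vec_atlas (\<lambda>\<epsilon>. mom1 (\<gamma> \<epsilon>) k) (mom1 c k) (mom1 \<delta> k) \<and>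
        tangent_curve vec_atlas (\<lambda>\<epsilon>. mom2 (\<gamma> \<epsilon>) k) (mom2 c k) (mom2 \<delta> k))"

text \<open>
  The differential of \<open>F\<close> at \<open>c\<close> takes the value \<open>d\<close> on \<open>\<delta>\<close>: this is the derivative of \<open>F\<close> along
  any curve representing the tangent vector \<open>\<delta>\<close>.
\<close>

definition has_differential ::
  "('g::topological_space, 'e::real_normed_vector) atlas \<Rightarrow> nat \<Rightarrow>
   (('g, 'e dual) discrete_curve \<Rightarrow> real) \<Rightarrow>
   ('g, 'e dual) discrete_curve \<Rightarrow> ('e, 'e dual) discrete_curve \<Rightarrow> real \<Rightarrow> bool"
where
  "has_differential A M F c \<delta> d \<longleftrightarrow>
     (\<forall>\<gamma>. variation_curve A M \<gamma> c \<delta> \<longrightarrow> ((\<lambda>\<epsilon>. F (\<gamma> \<epsilon>)) has_real_derivative d) (at 0))"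

definition critical_fixed_endpoints ::
  "('g::topological_space, 'e::real_normed_vector) atlas \<Rightarrow> nat \<Rightarrow>
   (('g, 'e dual) discrete_curve \<Rightarrow> real) \<Rightarrow> ('g, 'e dual) discrete_curve \<Rightarrow> bool"
where
  "critical_fixed_endpoints A M F c \<longleftrightarrow>
     (\<forall>\<delta>. node \<delta> 0 = 0 \<and> node \<delta> M = 0 \<longrightarrow> has_differential A M F c \<delta> 0)"


subsection \<open>Wiener processes\<close>

definition wiener_process :: "'w measure \<Rightarrow> (real \<Rightarrow> 'w \<Rightarrow> real) \<Rightarrow> bool" where
  "wiener_process P W \<longleftrightarrow>
     (\<forall>t\<ge>0. W t \<in> borel_measurable P) \<and>
     (AE \<omega> in P. W 0 \<omega> = 0) \<and>
     (AE \<omega> in P. continuous_on {0..} (\<lambda>t. W t \<omega>)) \<and>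
     (\<forall>s t. 0 \<le> s \<and> s < t \<longrightarrow>
        distributed P lborel (\<lambda>\<omega>. W t \<omega> - W s \<omega>) (normal_density 0 (sqrt (t - s)))) \<and>
     (\<forall>(n::nat) t. 0 \<le> t 0 \<and> (\<forall>j<n. t j \<le> t (Suc j)) \<longrightarrow>
        prob_space.indep_vars P (\<lambda>_. borel) (\<lambda>j \<omega>. W (t (Suc j)) \<omega> - W (t j) \<omega>) {..<n})"

definition independent_wiener_processes ::
  "'w measure \<Rightarrow> nat \<Rightarrow> (nat \<Rightarrow> real \<Rightarrow> 'w \<Rightarrow> real) \<Rightarrow> bool"
where
  "independent_wiener_processes P N W \<longleftrightarrow>
     prob_space P \<and>
     (\<forall>i\<in>{1..N}. wiener_process P (W i)) \<and>
     prob_space.indep_vars P (\<lambda>_. Pi\<^sub>M {0..} (\<lambda>_. borel)) (\<lambda>i \<omega>. \<lambda>t\<in>{0..}. W i t \<omega>) {1..N}"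

definition wiener_increment ::
  "(nat \<Rightarrow> real \<Rightarrow> 'w \<Rightarrow> real) \<Rightarrow> real \<Rightarrow> 'w \<Rightarrow> nat \<Rightarrow> nat \<Rightarrow> real"
where
  "wiener_increment W \<Delta>t \<omega> i k = W i (real k * \<Delta>t) \<omega> - W i (real (k - 1) * \<Delta>t) \<omega>"

end

theory Submission
  imports Defs
begin

text \<open>
  Write the variations of the group elements as left translates, of \<open>\<alpha>\<^sub>k\<close> at the nodes and of
  \<open>\<beta>\<^sub>k\<close> at the stages. If \<open>p\<close> and \<open>q\<close> vary by \<open>p\<beta>\<close> and \<open>q\<alpha>\<close>,
  then \<open>f = p\<^sup>-\<^sup>1 q\<close> varies by \<open>(Ad\<^sub>f \<alpha> - \<beta>) f\<close> (\<open>has_velocity_inv_mult\<close>), so \<open>\<tau>\<^sup>-\<^sup>1(f)\<close> varies by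
  the right-trivialized derivative of \<open>\<tau>\<^sup>-\<^sup>1\<close> applied to \<open>Ad\<^sub>f \<alpha> - \<beta>\<close>
  (\<open>has_velocity_retraction_inverse\<close>). Each step contains two such elements, one from the previous
  node to the stage and one from the stage to the next node. Moving the derivatives of \<open>\<tau>\<^sup>-\<^sup>1\<close> and
  \<open>Ad\<close> to the momenta by duality writes the differential of the action as a sum of pairings with
  \<open>\<alpha>\<^sub>k\<close>, \<open>\<beta>\<^sub>k\<close> and the variations of the two momenta (\<open>action_step_has_derivative\<close>).

  A node is the end of one step and the start of the next, so a summation by parts collects the two
  terms containing \<open>\<alpha>\<^sub>k\<close>. The boundary terms vanish since the end points are fixed. All remaining
  variations are independent, and the differential vanishes iff each coefficient does
  (\<open>discrete_fundamental_lemma\<close>): the coefficients of \<open>\<beta>\<^sub>k\<close>, \<open>\<alpha>\<^sub>k\<close> and the momentum variations are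
  the three groups of midpoint equations.

  Two facts make this rigorous. Every coordinate velocity is represented by a smooth curve
  (\<open>exists_tangent_curve\<close>), so criticality along curves says that the formula for the differential
  vanishes, and not merely that nothing can be tested. The Lie algebra is reflexive
  (\<open>bidual_representation\<close>), so that \<^const>\<open>partial_momentum\<close> is an actual gradient.
\<close>


section \<open>Curves with prescribed velocity\<close>

lemma C_k_on_cong:
  assumes "open S" "\<And>x. x \<in> S \<Longrightarrow> f x = g x" "C_k_on k f S"
  shows "C_k_on k g S"
  using assms(2,3)
proof (induction k arbitrary: f g)
  case 0
  then show ?case
    using continuous_on_cong by fastforce
next
  case (Suc k)
  have hd: "(g has_derivative frechet_derivative f (at x)) (at x)" if "x \<in> S" for x
  proof (rule has_derivative_transform_within_open[OF _ \<open>open S\<close> that])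
    show "(f has_derivative frechet_derivative f (at x)) (at x)"
      using Suc.prems(2) that by (simp add: frechet_derivative_works)
  qed (use Suc.prems in auto)
  have "C_k_on k (\<lambda>x. frechet_derivative g (at x) v) S" for v
  proof (rule Suc.IH)
    show "C_k_on k (\<lambda>x. frechet_derivative f (at x) v) S"
      using Suc.prems(2) by simp
    show "frechet_derivative f (at x) v = frechet_derivative g (at x) v" if "x \<in> S" for x
      using frechet_derivative_at[OF hd[OF that]] by simp
  qed
  moreover have "g differentiable (at x)" if "x \<in> S" for x
    using hd[OF that] by (auto simp: differentiable_def)
  ultimately show ?case by simp
qed

text \<open>
  For the curves needed below the only composition of C^k maps to be treated is that with an affine
  line. There the derivative in direction \<open>s\<close> is again a directional derivative of \<open>F\<close>, in the
  constant direction \<open>s *\<^sub>R v\<close>, so that the induction over \<open>k\<close> closes without a product rule.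
\<close>

lemma C_k_on_along_line:
  fixes F :: "'a::real_normed_vector \<Rightarrow> 'b::real_normed_vector"
  assumes "open T" "\<And>t. t \<in> T \<Longrightarrow> x + t *\<^sub>R v \<in> S" "C_k_on k F S"
  shows "C_k_on k (\<lambda>t. F (x + t *\<^sub>R v)) T"
  using assms(3)
proof (induction k arbitrary: F)
  case 0
  then have "continuous_on S F" by simp
  then have "continuous_on T (\<lambda>t. F (x + t *\<^sub>R v))"
    by (rule continuous_on_compose2) (use assms(2) in \<open>auto intro!: continuous_intros\<close>)
  then show ?case by simp
next
  case (Suc k)
  have hd: "((\<lambda>t. F (x + t *\<^sub>R v)) has_derivative
      (\<lambda>s. frechet_derivative F (at (x + t *\<^sub>R v)) (s *\<^sub>R v))) (at t)" if "t \<in> T" for t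
  proof (rule has_derivative_compose[where f = "\<lambda>t. x + t *\<^sub>R v"])
    show "((\<lambda>t. x + t *\<^sub>R v) has_derivative (\<lambda>s. s *\<^sub>R v)) (at t)"
      by (auto intro!: derivative_eq_intros)
    show "(F has_derivative frechet_derivative F (at (x + t *\<^sub>R v))) (at (x + t *\<^sub>R v))"
      using Suc.prems assms(2)[OF that] by (simp add: frechet_derivative_works)
  qed
  have "C_k_on k (\<lambda>t. frechet_derivative (\<lambda>t. F (x + t *\<^sub>R v)) (at t) s) T" for s
  proof (rule C_k_on_cong[OF \<open>open T\<close>])
    show "C_k_on k (\<lambda>t. frechet_derivative F (at (x + t *\<^sub>R v)) (s *\<^sub>R v)) T"
      using Suc.prems by (intro Suc.IH) simp
  qed (use frechet_derivative_at[OF hd] in metis)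
  moreover have "(\<lambda>t. F (x + t *\<^sub>R v)) differentiable (at t)" if "t \<in> T" for t
    using hd[OF that] by (auto simp: differentiable_def)
  ultimately show ?case by simp
qed

lemma isCont_openE:
  assumes "isCont f x" "open V" "f x \<in> V"
  obtains T where "open T" "x \<in> T" "\<And>t. t \<in> T \<Longrightarrow> f t \<in> V"
proof -
  have "\<exists>T. open T \<and> x \<in> T \<and> (\<forall>t\<in>T. f t \<in> V)"
    using assms(1)[unfolded continuous_at_open, rule_format, OF conjI, OF assms(2,3)] .
  then show thesis using that by metis
qed

lemma chart_atE:
  assumes "smooth_atlas A"
  obtains U \<phi> where "chart_at A p = (U, \<phi>)" "(U, \<phi>) \<in> A" "p \<in> U" "open U" "open (\<phi> ` U)"
    "inj_on \<phi> U" "continuous_on (\<phi> ` U) (inv_into U \<phi>)"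
proof -
  have "p \<in> (\<Union>(U, \<phi>)\<in>A. U)" using assms by (simp add: smooth_atlas_def)
  then have "\<exists>c. c \<in> A \<and> p \<in> fst c" by auto
  then have *: "chart_at A p \<in> A \<and> p \<in> fst (chart_at A p)"
    unfolding chart_at_def by (rule someI_ex)
  obtain U \<phi> where c: "chart_at A p = (U, \<phi>)" by force
  with * have U: "(U, \<phi>) \<in> A" "p \<in> U" by auto
  with assms have "open U" "open (\<phi> ` U)" and h: "homeomorphism U (\<phi> ` U) \<phi> (inv_into U \<phi>)"
    by (auto simp: smooth_atlas_def)
  moreover have "inj_on \<phi> U"
    using h by (intro inj_on_inverseI[where g = "inv_into U \<phi>"]) (auto simp: homeomorphism_def)
  moreover have "continuous_on (\<phi> ` U) (inv_into U \<phi>)"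
    using h by (auto simp: homeomorphism_def)
  ultimately show thesis using that c U by blast
qed

lemma chart_at_vec_atlas [simp]: "chart_at vec_atlas p = (UNIV, id)"
  unfolding chart_at_def vec_atlas_def by (rule some_equality) simp_all

lemma C_k_on_const: "C_k_on k (\<lambda>x. c) S"
proof (induction k arbitrary: c)
  case (Suc k)
  then show ?case by (simp add: frechet_derivative_const)
qed simp

lemma smooth_atlas_vec_atlas: "smooth_atlas vec_atlas"
proof -
  have "C_k_on k id (UNIV :: 'a set)" for k
    by (cases k) (auto simp: id_def C_k_on_const)
  then show ?thesis
    by (auto simp: smooth_atlas_def vec_atlas_def smooth_on_def homeomorphism_def)
qed

text \<open>A straight line in the preferred chart represents any given coordinate velocity.\<close>

lemma exists_tangent_curve:
  fixes A :: "('p::topological_space, 'e::real_normed_vector) atlas"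
  assumes "smooth_atlas A"
  shows "\<exists>\<gamma>. tangent_curve A \<gamma> p v"
proof -
  obtain U \<phi> where c: "chart_at A p = (U, \<phi>)" "(U, \<phi>) \<in> A" and p: "p \<in> U" and o: "open U" "open (\<phi> ` U)"
    and inj: "inj_on \<phi> U" and cont: "continuous_on (\<phi> ` U) (inv_into U \<phi>)"
    by (rule chart_atE[OF assms, of p]) (rule that)
  define l where "l t = \<phi> p + t *\<^sub>R v" for t :: real
  have "isCont l 0" unfolding l_def by (intro continuous_intros)
  then have "\<forall>\<^sub>F t in nhds 0. l t \<in> \<phi> ` U"
    using o(2) p by (auto simp: continuous_at_open eventually_nhds l_def)
  \<comment> \<open>Outside this interval the line may leave the image of the chart, where \<open>inv_into\<close> is arbitrary.\<close>
  then obtain r where r: "r > 0" "\<And>t. \<bar>t\<bar> < r \<Longrightarrow> l t \<in> \<phi> ` U"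
    by (auto simp: eventually_nhds_metric dist_real_def)
  define \<gamma> where "\<gamma> t = inv_into U \<phi> (l t)" for t
  have \<gamma>_chart: "\<gamma> t \<in> U" "\<phi> (\<gamma> t) = l t" if "\<bar>t\<bar> < r" for t
    using r(2)[OF that] by (auto simp: \<gamma>_def inv_into_into f_inv_into_f)
  have cont_\<gamma>: "continuous_on {-r<..<r} \<gamma>"
    unfolding \<gamma>_def
    by (rule continuous_on_compose2[OF cont]) (use r(2) in \<open>auto simp: l_def intro!: continuous_intros\<close>)
  have "smooth_on (\<psi> \<circ> \<gamma>) ({-r<..<r} \<inter> \<gamma> -` V)" if V: "(V, \<psi>) \<in> A" for V \<psi>
    unfolding smooth_on_def
  proof
    fix k
    have "open V" using assms V by (auto simp: smooth_atlas_def)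
    then have "open ({-r<..<r} \<inter> \<gamma> -` V)"
      by (intro continuous_open_preimage cont_\<gamma>) auto
    moreover have "C_k_on k (\<psi> \<circ> inv_into U \<phi>) (\<phi> ` (U \<inter> V))"
      using assms c V by (fastforce simp: smooth_atlas_def smooth_on_def)
    moreover have "\<phi> p + t *\<^sub>R v \<in> \<phi> ` (U \<inter> V)" if "t \<in> {-r<..<r} \<inter> \<gamma> -` V" for t
      using \<gamma>_chart[of t] that by (auto simp: l_def intro!: image_eqI[where x = "\<gamma> t"])
    ultimately have "C_k_on k (\<lambda>t. (\<psi> \<circ> inv_into U \<phi>) (\<phi> p + t *\<^sub>R v)) ({-r<..<r} \<inter> \<gamma> -` V)"
      by (intro C_k_on_along_line[where S = "\<phi> ` (U \<inter> V)"])
    then show "C_k_on k (\<psi> \<circ> \<gamma>) ({-r<..<r} \<inter> \<gamma> -` V)"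
      by (simp add: o_def \<gamma>_def l_def)
  qed
  then have "smooth_map_on vec_atlas A {-r<..<r} \<gamma>"
    using cont_\<gamma> by (auto simp: smooth_map_on_def vec_atlas_def)
  moreover have "\<gamma> 0 = p"
    using p inj by (simp add: \<gamma>_def l_def)
  moreover have "((\<phi> \<circ> \<gamma>) has_vector_derivative v) (at 0)"
  proof (rule has_vector_derivative_transform_within_open[where S = "{-r<..<r}"])
    show "(l has_vector_derivative v) (at 0)"
      unfolding l_def by (auto intro!: derivative_eq_intros)
  qed (use r(1) \<gamma>_chart in auto)
  ultimately show ?thesis
    using r(1) c by (auto simp: tangent_curve_def)
qed


section \<open>Velocities and tangent maps\<close>

text \<open>
  First-order data at time 0 suffice to differentiate the action along a curve. Asking for them
  only, instead of smoothness as in \<^const>\<open>tangent_curve\<close>, gives a notion that is preserved by every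
  map differentiable at the base point, so that the ordinary chain rule suffices.
\<close>

definition has_velocity ::
  "('p::t2_space, 'e::real_normed_vector) atlas \<Rightarrow> (real \<Rightarrow> 'p) \<Rightarrow> 'p \<Rightarrow> 'e \<Rightarrow> bool"
where
  "has_velocity A \<gamma> p v \<longleftrightarrow>
     \<gamma> 0 = p \<and> isCont \<gamma> 0 \<and> ((snd (chart_at A p) \<circ> \<gamma>) has_vector_derivative v) (at 0)"

definition manifold_differentiable ::
  "('p::t2_space, 'e::real_normed_vector) atlas \<Rightarrow>
   ('q::t2_space, 'f::real_normed_vector) atlas \<Rightarrow> ('p \<Rightarrow> 'q) \<Rightarrow> 'p \<Rightarrow> bool"
where
  "manifold_differentiable A B f p \<longleftrightarrow>
     isCont f p \<and>
     (snd (chart_at B (f p)) \<circ> f \<circ> inv_into (fst (chart_at A p)) (snd (chart_at A p)))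
       differentiable (at (snd (chart_at A p) p))"

lemma has_velocity_unique:
  "has_velocity A \<gamma> p v \<Longrightarrow> has_velocity A \<gamma> p w \<Longrightarrow> v = w"
  unfolding has_velocity_def by (elim conjE) (rule vector_derivative_unique_at)

lemma has_velocity_vec_atlas:
  "has_velocity vec_atlas \<gamma> p v \<longleftrightarrow> \<gamma> 0 = p \<and> (\<gamma> has_vector_derivative v) (at 0)"
  using has_vector_derivative_continuous[of \<gamma> v 0 UNIV] by (auto simp: has_velocity_def)

lemma tangent_curve_has_velocity:
  assumes "tangent_curve A \<gamma> p v"
  shows "has_velocity A \<gamma> p v"
proof -
  obtain r where r: "r > 0" "smooth_map_on vec_atlas A {-r<..<r} \<gamma>"
    using assms by (auto simp: tangent_curve_def)
  then have "isCont \<gamma> 0"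
    by (auto simp: smooth_map_on_def continuous_on_eq_continuous_at)
  then show ?thesis
    using assms by (auto simp: has_velocity_def tangent_curve_def)
qed

lemma exists_has_velocity: "smooth_atlas A \<Longrightarrow> \<exists>\<gamma>. has_velocity A \<gamma> p v"
  using exists_tangent_curve[of A p v] tangent_curve_has_velocity[of A _ p v] by blast

lemma blinfun_apply_tangent_map:
  assumes "manifold_differentiable A B f p"
  shows "((snd (chart_at B (f p)) \<circ> f \<circ> inv_into (fst (chart_at A p)) (snd (chart_at A p)))
    has_derivative blinfun_apply (tangent_map A B f p)) (at (snd (chart_at A p) p))"
proof -
  have "(snd (chart_at B (f p)) \<circ> f \<circ> inv_into (fst (chart_at A p)) (snd (chart_at A p)))
       differentiable (at (snd (chart_at A p) p))"
    using assms by (simp add: manifold_differentiable_def)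
  then have D: "((snd (chart_at B (f p)) \<circ> f \<circ> inv_into (fst (chart_at A p)) (snd (chart_at A p)))
      has_derivative frechet_derivative (snd (chart_at B (f p)) \<circ> f \<circ>
        inv_into (fst (chart_at A p)) (snd (chart_at A p))) (at (snd (chart_at A p) p)))
      (at (snd (chart_at A p) p))"
    by (simp only: frechet_derivative_works)
  show ?thesis
    unfolding tangent_map_def case_prod_beta Let_def
      bounded_linear_Blinfun_apply[OF has_derivative_bounded_linear[OF D]]
    by (rule D)
qed

lemma has_velocity_map:
  assumes "smooth_atlas A" "has_velocity A \<gamma> p v" "manifold_differentiable A B f p"
  shows "has_velocity B (\<lambda>t. f (\<gamma> t)) (f p) (tangent_map A B f p v)"
proof -
  obtain U \<phi> where c: "chart_at A p = (U, \<phi>)" and p: "p \<in> U" "open U" "inj_on \<phi> U"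
    by (rule chart_atE[OF assms(1), of p]) (rule that)
  let ?\<psi> = "snd (chart_at B (f p))"
  have \<gamma>: "\<gamma> 0 = p" "isCont \<gamma> 0" "((\<phi> \<circ> \<gamma>) has_vector_derivative v) (at 0)"
    using assms(2) c by (auto simp: has_velocity_def)
  have D: "((?\<psi> \<circ> f \<circ> inv_into U \<phi>) has_derivative blinfun_apply (tangent_map A B f p)) (at ((\<phi> \<circ> \<gamma>) 0))"
    using blinfun_apply_tangent_map[OF assms(3)] c \<gamma>(1) by simp
  have *: "(((?\<psi> \<circ> f \<circ> inv_into U \<phi>) \<circ> (\<phi> \<circ> \<gamma>)) has_vector_derivative tangent_map A B f p v) (at 0)"
    using vector_derivative_diff_chain_within[OF \<gamma>(3) has_derivative_at_withinI[OF D]] .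
  obtain T where T: "open T" "0 \<in> T" "\<And>t. t \<in> T \<Longrightarrow> \<gamma> t \<in> U"
    using isCont_openE[of 0 \<gamma> U] \<gamma> p by metis
  have "((?\<psi> \<circ> (\<lambda>t. f (\<gamma> t))) has_vector_derivative tangent_map A B f p v) (at 0)"
    by (rule has_vector_derivative_transform_within_open[OF *]) (use p T in auto)
  moreover have "isCont (\<lambda>t. f (\<gamma> t)) 0"
    by (rule isCont_o2[where g = f]) (use \<gamma> assms(3) in \<open>simp_all add: manifold_differentiable_def\<close>)
  ultimately show ?thesis using \<gamma>(1) by (auto simp: has_velocity_def)
qed

lemma manifold_differentiable_compose:
  assumes "smooth_atlas A" "smooth_atlas B"
    "manifold_differentiable A B f p" "manifold_differentiable B C g (f p)"
  shows "manifold_differentiable A C (\<lambda>x. g (f x)) p"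
proof -
  obtain U \<phi> where c: "chart_at A p = (U, \<phi>)" and p: "p \<in> U" "open U" "inj_on \<phi> U" "open (\<phi> ` U)"
    and cont: "continuous_on (\<phi> ` U) (inv_into U \<phi>)"
    by (rule chart_atE[OF assms(1), of p]) (rule that)
  obtain V \<psi> where d: "chart_at B (f p) = (V, \<psi>)" and q: "f p \<in> V" "open V" "inj_on \<psi> V"
    by (rule chart_atE[OF assms(2), of "f p"]) (rule that)
  let ?\<theta> = "snd (chart_at C (g (f p)))"
  have "(\<psi> \<circ> f \<circ> inv_into U \<phi>) differentiable (at (\<phi> p))"
    using assms(3) c d by (simp add: manifold_differentiable_def)
  moreover have "(?\<theta> \<circ> g \<circ> inv_into V \<psi>) differentiable (at ((\<psi> \<circ> f \<circ> inv_into U \<phi>) (\<phi> p)))"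
    using assms(4) c d p by (simp add: manifold_differentiable_def)
  ultimately have *: "((?\<theta> \<circ> g \<circ> inv_into V \<psi>) \<circ> (\<psi> \<circ> f \<circ> inv_into U \<phi>)) differentiable (at (\<phi> p))"
    by (rule differentiable_chain_at)
  have "isCont (f \<circ> inv_into U \<phi>) (\<phi> p)"
    using assms(3) p cont
    by (intro continuous_at_compose continuous_on_interior[OF cont])
      (simp_all add: manifold_differentiable_def interior_open)
  moreover have "(f \<circ> inv_into U \<phi>) (\<phi> p) \<in> V"
    using p q by simp
  ultimately obtain T where T: "open T" "\<phi> p \<in> T" "\<And>t. t \<in> T \<Longrightarrow> (f \<circ> inv_into U \<phi>) t \<in> V"
    using isCont_openE[OF _ q(2)] by metis
  have "(?\<theta> \<circ> (\<lambda>x. g (f x)) \<circ> inv_into U \<phi>) differentiable (at (\<phi> p))"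
  proof -
    obtain D where D: "(((?\<theta> \<circ> g \<circ> inv_into V \<psi>) \<circ> (\<psi> \<circ> f \<circ> inv_into U \<phi>)) has_derivative D) (at (\<phi> p))"
      using * unfolding differentiable_def by blast
    have "((?\<theta> \<circ> (\<lambda>x. g (f x)) \<circ> inv_into U \<phi>) has_derivative D) (at (\<phi> p))"
      by (rule has_derivative_transform_within_open[OF D T(1,2)])
        (use T(3) in \<open>simp add: inv_into_f_f[OF q(3)]\<close>)
    then show ?thesis unfolding differentiable_def by blast
  qed
  moreover have "isCont (\<lambda>x. g (f x)) p"
    by (rule isCont_o2[where g = g]) (use assms(3,4) in \<open>simp_all add: manifold_differentiable_def\<close>)
  ultimately show ?thesis
    using c by (simp add: manifold_differentiable_def)
qed

lemma smooth_map_on_imp_manifold_differentiable: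
  assumes "smooth_atlas A" "smooth_atlas B" "smooth_map_on A B S f" "open S" "p \<in> S"
  shows "manifold_differentiable A B f p"
proof -
  obtain U \<phi> where c: "chart_at A p = (U, \<phi>)" "(U, \<phi>) \<in> A" "p \<in> U"
    by (rule chart_atE[OF assms(1), of p]) (rule that)
  obtain V \<psi> where d: "chart_at B (f p) = (V, \<psi>)" "(V, \<psi>) \<in> B" "f p \<in> V"
    by (rule chart_atE[OF assms(2), of "f p"]) (rule that)
  have "smooth_on (\<psi> \<circ> f \<circ> inv_into U \<phi>) (\<phi> ` (U \<inter> S \<inter> f -` V))"
    using assms(3) c d by (fastforce simp: smooth_map_on_def)
  then have "C_k_on (Suc 0) (\<psi> \<circ> f \<circ> inv_into U \<phi>) (\<phi> ` (U \<inter> S \<inter> f -` V))"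
    unfolding smooth_on_def by blast
  then have "(\<psi> \<circ> f \<circ> inv_into U \<phi>) differentiable (at (\<phi> p))"
    using c d assms(5) by auto
  moreover have "isCont f p"
    using assms by (auto simp: smooth_map_on_def continuous_on_eq_continuous_at)
  ultimately show ?thesis using c d by (simp add: manifold_differentiable_def)
qed

lemma tangent_map_ident:
  assumes "smooth_atlas A"
  shows "tangent_map A A (\<lambda>x. x) p v = v"
proof -
  obtain U \<phi> where c: "chart_at A p = (U, \<phi>)" and p: "p \<in> U" "open U" "inj_on \<phi> U" "open (\<phi> ` U)"
    by (rule chart_atE[OF assms(1), of p]) (rule that)
  have "((\<phi> \<circ> (\<lambda>x. x) \<circ> inv_into U \<phi>) has_derivative (\<lambda>v. v)) (at (\<phi> p))"
    by (rule has_derivative_transform_within_open[OF has_derivative_ident, where s = "\<phi> ` U"])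
      (use p in \<open>auto simp: f_inv_into_f\<close>)
  then have "frechet_derivative (\<phi> \<circ> (\<lambda>x. x) \<circ> inv_into U \<phi>) (at (\<phi> p)) = (\<lambda>v. v)"
    using frechet_derivative_at by metis
  then show ?thesis
    using c by (simp add: tangent_map_def bounded_linear_Blinfun_apply bounded_linear_ident)
qed

text \<open>
  Tangent maps are determined by their effect on velocities of curves, which reduces the chain rule
  to \<open>has_velocity_map\<close>.
\<close>

lemma tangent_map_compose:
  assumes "smooth_atlas A" "smooth_atlas B"
    "manifold_differentiable A B f p" "manifold_differentiable B C g (f p)"
  shows "tangent_map A C (\<lambda>x. g (f x)) p v = tangent_map B C g (f p) (tangent_map A B f p v)"
proof -
  obtain \<gamma> where \<gamma>: "has_velocity A \<gamma> p v"
    using exists_has_velocity[OF assms(1)] by blast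
  have "has_velocity C (\<lambda>t. g (f (\<gamma> t))) (g (f p)) (tangent_map A C (\<lambda>x. g (f x)) p v)"
    using has_velocity_map[OF assms(1) \<gamma> manifold_differentiable_compose[OF assms]] .
  moreover have "has_velocity C (\<lambda>t. g (f (\<gamma> t))) (g (f p))
      (tangent_map B C g (f p) (tangent_map A B f p v))"
    using has_velocity_map[OF assms(2) has_velocity_map[OF assms(1) \<gamma> assms(3)] assms(4)] .
  ultimately show ?thesis by (rule has_velocity_unique)
qed

text \<open>
  The preferred chart of \<^const>\<open>prod_atlas\<close> at a pair of points is unrelated to the preferred charts
  of the two points. The product of the latter also belongs to \<^const>\<open>prod_atlas\<close>; in this chart the
  total derivative splits into the two partial tangent maps.
\<close>

lemma smooth_map_on_product:
  fixes A :: "('p::t2_space, 'd::real_normed_vector) atlas"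
    and B :: "('q::t2_space, 'e::real_normed_vector) atlas"
    and C :: "('r::t2_space, 'f::real_normed_vector) atlas"
  assumes at: "smooth_atlas A" "smooth_atlas B" "smooth_atlas C"
    and f: "smooth_map_on (prod_atlas A B) C UNIV (\<lambda>(x, y). f x y)"
  shows smooth_map_on_product_fst: "manifold_differentiable A C (\<lambda>x. f x q) p"
    and smooth_map_on_product_snd: "manifold_differentiable B C (f p) q"
    and has_velocity_product: "has_velocity A \<gamma> p u \<Longrightarrow> has_velocity B \<eta> q v \<Longrightarrow>
      has_velocity C (\<lambda>t. f (\<gamma> t) (\<eta> t)) (f p q)
        (tangent_map A C (\<lambda>x. f x q) p u + tangent_map B C (f p) q v)"
proof -
  obtain U \<phi> where c: "chart_at A p = (U, \<phi>)" "(U, \<phi>) \<in> A" "p \<in> U" "open U" "inj_on \<phi> U" "open (\<phi> ` U)"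
    by (rule chart_atE[OF at(1), of p]) (rule that)
  obtain V \<psi> where d: "chart_at B q = (V, \<psi>)" "(V, \<psi>) \<in> B" "q \<in> V" "open V" "inj_on \<psi> V" "open (\<psi> ` V)"
    by (rule chart_atE[OF at(2), of q]) (rule that)
  obtain W \<theta> where e: "chart_at C (f p q) = (W, \<theta>)" "(W, \<theta>) \<in> C" "f p q \<in> W" "open W"
    by (rule chart_atE[OF at(3), of "f p q"]) (rule that)
  define F where "F = \<theta> \<circ> (\<lambda>(x, y). f x y) \<circ> inv_into (U \<times> V) (map_prod \<phi> \<psi>)"
  have prod_inv: "inv_into (U \<times> V) (map_prod \<phi> \<psi>) (\<phi> x, \<psi> y) = (x, y)" if "x \<in> U" "y \<in> V" for x y
  proof -
    have "inj_on (map_prod \<phi> \<psi>) (U \<times> V)"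
      using c d by (intro map_prod_inj_on)
    then show ?thesis using that inv_into_f_f[of "map_prod \<phi> \<psi>" "U \<times> V" "(x, y)"] by simp
  qed
  have F: "F (\<phi> x, \<psi> y) = \<theta> (f x y)" if "x \<in> U" "y \<in> V" for x y
    using prod_inv[OF that] by (simp add: F_def)
  have "(U \<times> V, map_prod \<phi> \<psi>) \<in> prod_atlas A B"
    using c d by (auto simp: prod_atlas_def)
  then have "smooth_on F (map_prod \<phi> \<psi> ` (U \<times> V \<inter> UNIV \<inter> (\<lambda>(x, y). f x y) -` W))"
    using f e unfolding smooth_map_on_def F_def by blast
  then have "C_k_on (Suc 0) F (map_prod \<phi> \<psi> ` (U \<times> V \<inter> UNIV \<inter> (\<lambda>(x, y). f x y) -` W))"
    unfolding smooth_on_def by blast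
  moreover have "(\<phi> p, \<psi> q) \<in> map_prod \<phi> \<psi> ` (U \<times> V \<inter> UNIV \<inter> (\<lambda>(x, y). f x y) -` W)"
    using c d e by (auto intro!: image_eqI[where x = "(p, q)"])
  ultimately have "F differentiable (at (\<phi> p, \<psi> q))"
    by (simp only: C_k_on.simps)
  then obtain D where D: "(F has_derivative D) (at (\<phi> p, \<psi> q))"
    by (auto simp: differentiable_def)
  have cont: "continuous_on UNIV (\<lambda>(x, y). f x y)"
    using f by (simp add: smooth_map_on_def)
  have isC: "isCont (\<lambda>t. f (a t) (b t)) t" if "isCont a t" "isCont b t"
    for a :: "'z::t2_space \<Rightarrow> 'p" and b :: "'z \<Rightarrow> 'q" and t
  proof -
    have "isCont (\<lambda>z. (a z, b z)) t" using that by (rule continuous_Pair)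
    moreover have "isCont (\<lambda>(x, y). f x y) (a t, b t)"
      using cont by (simp add: continuous_on_eq_continuous_at)
    ultimately show ?thesis using isCont_o2 by fastforce
  qed
  have D1: "((\<theta> \<circ> (\<lambda>x. f x q) \<circ> inv_into U \<phi>) has_derivative (\<lambda>a. D (a, 0))) (at (\<phi> p))"
  proof (rule has_derivative_transform_within_open[where s = "\<phi> ` U"])
    show "((\<lambda>a. F (a, \<psi> q)) has_derivative (\<lambda>a. D (a, 0))) (at (\<phi> p))"
      by (rule has_derivative_compose[where f = "\<lambda>a. (a, \<psi> q)", OF _ D])
        (auto intro!: derivative_eq_intros)
  qed (use c d F in auto)
  have D2: "((\<theta> \<circ> f p \<circ> inv_into V \<psi>) has_derivative (\<lambda>b. D (0, b))) (at (\<psi> q))"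
  proof (rule has_derivative_transform_within_open[where s = "\<psi> ` V"])
    show "((\<lambda>b. F (\<phi> p, b)) has_derivative (\<lambda>b. D (0, b))) (at (\<psi> q))"
      by (rule has_derivative_compose[where f = "\<lambda>b. (\<phi> p, b)", OF _ D])
        (auto intro!: derivative_eq_intros)
  qed (use c d F in auto)
  show m1: "manifold_differentiable A C (\<lambda>x. f x q) p"
    using c e D1 isC[of p "\<lambda>x. x" "\<lambda>x. q"]
    by (auto simp: manifold_differentiable_def differentiable_def)
  show m2: "manifold_differentiable B C (f p) q"
    using d e D2 isC[of q "\<lambda>x. p" "\<lambda>x. x"]
    by (auto simp: manifold_differentiable_def differentiable_def)
  assume \<gamma>: "has_velocity A \<gamma> p u" and \<eta>: "has_velocity B \<eta> q v"
  have T1: "tangent_map A C (\<lambda>x. f x q) p u = D (u, 0)"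
    using has_derivative_unique[OF blinfun_apply_tangent_map[OF m1]] c e D1 by (metis fst_conv snd_conv)
  have T2: "tangent_map B C (f p) q v = D (0, v)"
    using has_derivative_unique[OF blinfun_apply_tangent_map[OF m2]] d e D2 by (metis fst_conv snd_conv)
  have "D (u, v) = D (u, 0) + D (0, v)"
    using has_derivative_linear[OF D] linear_add[of D "(u, 0)" "(0, v)"] by simp
  note sum = this[folded T1 T2]
  have pair: "((\<lambda>t. (\<phi> (\<gamma> t), \<psi> (\<eta> t))) has_vector_derivative (u, v)) (at 0)"
    using \<gamma> \<eta> c d by (auto simp: has_velocity_def o_def intro!: has_vector_derivative_Pair)
  have "(F has_derivative D) (at (\<phi> (\<gamma> 0), \<psi> (\<eta> 0)))"
    using \<gamma> \<eta> D by (simp add: has_velocity_def)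
  then have *: "(F \<circ> (\<lambda>t. (\<phi> (\<gamma> t), \<psi> (\<eta> t))) has_vector_derivative D (u, v)) (at 0)"
    by (rule vector_derivative_diff_chain_within[OF pair has_derivative_at_withinI])
  obtain T1 where T1: "open T1" "0 \<in> T1" "\<And>t. t \<in> T1 \<Longrightarrow> \<gamma> t \<in> U"
    using isCont_openE[of 0 \<gamma> U] \<gamma> c unfolding has_velocity_def by metis
  obtain T2 where T2: "open T2" "0 \<in> T2" "\<And>t. t \<in> T2 \<Longrightarrow> \<eta> t \<in> V"
    using isCont_openE[of 0 \<eta> V] \<eta> d unfolding has_velocity_def by metis
  have "((\<theta> \<circ> (\<lambda>t. f (\<gamma> t) (\<eta> t))) has_vector_derivative D (u, v)) (at 0)"
    by (rule has_vector_derivative_transform_within_open[OF *, where S = "T1 \<inter> T2"])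
      (use F T1 T2 in auto)
  then show "has_velocity C (\<lambda>t. f (\<gamma> t) (\<eta> t)) (f p q)
        (tangent_map A C (\<lambda>x. f x q) p u + tangent_map B C (f p) q v)"
    using \<gamma> \<eta> e isC[of 0 \<gamma> \<eta>] sum by (auto simp: has_velocity_def)
qed

section \<open>Trivialized velocities in a Lie group\<close>

context lie_group
begin

lemma in_carrier [simp]: "x \<in> carrier G"
  by (simp add: carrier_UNIV)

lemma left_mult_differentiable: "manifold_differentiable A A (\<lambda>x. g \<otimes> x) x"
  using smooth_map_on_product_snd[OF atlas atlas atlas smooth_mult] .

lemma right_mult_differentiable: "manifold_differentiable A A (\<lambda>x. x \<otimes> g) x"
  using smooth_map_on_product_fst[OF atlas atlas atlas smooth_mult] .

lemma inverse_differentiable: "manifold_differentiable A A (\<lambda>x. inv x) x"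
  by (rule smooth_map_on_imp_manifold_differentiable[OF atlas atlas smooth_inv]) simp_all

lemma conjugation_differentiable: "manifold_differentiable A A (\<lambda>x. g \<otimes> x \<otimes> inv g) x"
  by (rule manifold_differentiable_compose[OF atlas atlas left_mult_differentiable
        right_mult_differentiable])

lemmas has_velocity_mult = has_velocity_product[OF atlas atlas atlas smooth_mult]

lemma has_velocity_left_trans:
  assumes "has_velocity A \<gamma> \<one> v"
  shows "has_velocity A (\<lambda>t. g \<otimes> \<gamma> t) g (left_trans G A g v)"
  using has_velocity_map[OF atlas assms left_mult_differentiable[of g]]
  by (simp add: left_trans_def)

lemma has_velocity_right_trans:
  assumes "has_velocity A \<gamma> \<one> v"
  shows "has_velocity A (\<lambda>t. \<gamma> t \<otimes> g) g (right_trans G A g v)"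
  using has_velocity_map[OF atlas assms right_mult_differentiable[of g]]
  by (simp add: right_trans_def)

lemma has_velocity_Ad:
  assumes "has_velocity A \<gamma> \<one> v"
  shows "has_velocity A (\<lambda>t. g \<otimes> \<gamma> t \<otimes> inv g) \<one> (Ad G A g v)"
  using has_velocity_map[OF atlas assms conjugation_differentiable[of g]]
  by (simp add: Ad_def)

lemma has_velocity_mult_one:
  assumes "has_velocity A \<gamma> \<one> u" "has_velocity A \<eta> \<one> v"
  shows "has_velocity A (\<lambda>t. \<gamma> t \<otimes> \<eta> t) \<one> (u + v)"
  using has_velocity_mult[OF assms] by (simp add: tangent_map_ident[OF atlas])

lemma has_velocity_inv_one:
  assumes "has_velocity A \<gamma> \<one> v"
  shows "has_velocity A (\<lambda>t. inv (\<gamma> t)) \<one> (- v)"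
proof -
  let ?w = "tangent_map A A (\<lambda>x. inv x) \<one> v"
  have w: "has_velocity A (\<lambda>t. inv (\<gamma> t)) \<one> ?w"
    using has_velocity_map[OF atlas assms inverse_differentiable] by simp
  have "has_velocity A (\<lambda>t. \<one>) \<one> (v + ?w)"
    using has_velocity_mult_one[OF assms w] by simp
  moreover have "has_velocity A (\<lambda>t. \<one>) \<one> 0"
    by (simp add: has_velocity_def o_def)
  ultimately have "v + ?w = 0" by (rule has_velocity_unique)
  then have "?w = - v" by (simp add: add_eq_0_iff)
  then show ?thesis using w by simp
qed

text \<open>The inverse of \<^const>\<open>left_trans\<close>, used to trivialize an arbitrary variation.\<close>

definition left_log_deriv :: "'g \<Rightarrow> 'e \<Rightarrow>\<^sub>L 'e" where
  "left_log_deriv g = tangent_map A A (\<lambda>x. inv g \<otimes> x) g"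

lemma left_trans_left_log_deriv: "left_trans G A g (left_log_deriv g v) = v"
proof -
  have "left_trans G A g (left_log_deriv g v) = tangent_map A A (\<lambda>x. g \<otimes> (inv g \<otimes> x)) g v"
    using tangent_map_compose[OF atlas atlas left_mult_differentiable left_mult_differentiable,
        of g "inv g" g v]
    by (simp add: left_trans_def left_log_deriv_def)
  then show ?thesis
    by (simp add: m_assoc[symmetric] tangent_map_ident[OF atlas])
qed

text \<open>
  The velocity of a product or an inverse depends on the velocities of the factors only, so the two
  curves may be replaced by left translates \<open>p b\<close> and \<open>q a\<close> of curves through the identity. With
  \<open>f = p\<^sup>-\<^sup>1 q\<close> the quotient becomes \<open>b\<^sup>-\<^sup>1 (f a f\<^sup>-\<^sup>1) f\<close>, whose velocity can be read off
  at the identity. Thus the derivative of the inversion has to be computed at the identity only.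
\<close>

lemma has_velocity_inv_mult:
  assumes s: "has_velocity A s p (left_trans G A p \<beta>)"
    and n: "has_velocity A n q (left_trans G A q \<alpha>)"
  shows "has_velocity A (\<lambda>t. inv (s t) \<otimes> n t) (inv p \<otimes> q)
    (right_trans G A (inv p \<otimes> q) (Ad G A (inv p \<otimes> q) \<alpha> - \<beta>))"
proof -
  let ?f = "inv p \<otimes> q"
  obtain b where b: "has_velocity A b \<one> \<beta>"
    using exists_has_velocity[OF atlas] by blast
  obtain a where a: "has_velocity A a \<one> \<alpha>"
    using exists_has_velocity[OF atlas] by blast
  note quotient = has_velocity_mult[OF has_velocity_map[OF atlas _ inverse_differentiable]]
  note 1 = quotient[OF s n]
  note 2 = quotient[OF has_velocity_left_trans[OF b] has_velocity_left_trans[OF a], of p q]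
  have "has_velocity A (\<lambda>t. inv (b t) \<otimes> (?f \<otimes> a t \<otimes> inv ?f) \<otimes> ?f) ?f
      (right_trans G A ?f (- \<beta> + Ad G A ?f \<alpha>))"
    by (intro has_velocity_right_trans has_velocity_mult_one has_velocity_inv_one has_velocity_Ad a b)
  moreover have "p \<otimes> (inv p \<otimes> q) = q"
    by (simp add: m_assoc[symmetric])
  then have "inv (b t) \<otimes> (?f \<otimes> a t \<otimes> inv ?f) \<otimes> ?f = inv (p \<otimes> b t) \<otimes> (q \<otimes> a t)" for t
    by (simp add: m_assoc inv_mult_group)
  ultimately have "has_velocity A (\<lambda>t. inv (p \<otimes> b t) \<otimes> (q \<otimes> a t)) ?f
      (right_trans G A ?f (Ad G A ?f \<alpha> - \<beta>))"
    by simp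
  from has_velocity_unique[OF this 2] show ?thesis
    using 1 by simp
qed

text \<open>
  Both halves of a time step are of this form: the endpoint variation \<open>\<alpha>\<close> is transported by \<open>Ad\<close>, the
  starting point variation \<open>\<beta>\<close> is not. This is why \<open>Ad\<^sup>*\<close> occurs in one term of each of the stage
  and node equations.
\<close>

lemma has_velocity_retraction_inverse:
  assumes \<tau>: "lie_retraction G A \<tau> U" and f: "inv p \<otimes> q \<in> \<tau> ` U"
    and s: "has_velocity A s p (left_trans G A p \<beta>)"
    and n: "has_velocity A n q (left_trans G A q \<alpha>)"
  defines "\<zeta> \<equiv> inv_into U \<tau> (inv p \<otimes> q)"
  shows "((\<lambda>t. inv_into U \<tau> (inv (s t) \<otimes> n t)) has_vector_derivative
    d_tau_inv G A \<tau> U \<zeta> (Ad G A (\<tau> \<zeta>) \<alpha> - \<beta>)) (at 0)"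
proof -
  have "manifold_differentiable A vec_atlas (inv_into U \<tau>) (inv p \<otimes> q)"
    by (rule smooth_map_on_imp_manifold_differentiable[OF atlas smooth_atlas_vec_atlas _ _ f])
      (use \<tau> in \<open>simp_all add: lie_retraction_def\<close>)
  from has_velocity_map[OF atlas has_velocity_inv_mult[OF s n] this] show ?thesis
    by (simp add: has_velocity_vec_atlas d_tau_inv_def \<zeta>_def f_inv_into_f[OF f])
qed


section \<open>Variations of the Hamiltonians\<close>

text \<open>
  An orthogonal spanning set provides a dual basis, which makes the finite-dimensional Lie algebra
  reflexive. Hence the vector in the definition of \<^const>\<open>partial_momentum\<close> exists.
\<close>

lemma bidual_representation:
  fixes \<Lambda> :: "'e dual \<Rightarrow> real"
  assumes "linear \<Lambda>"
  shows "\<exists>!v. \<forall>\<nu>. \<Lambda> \<nu> = blinfun_apply \<nu> v"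
proof -
  obtain B :: "'e set" where B: "finite B" "span B = UNIV"
    using finite_dim by blast
  obtain C :: "'e set" where C: "finite C" "span C = UNIV" "pairwise orthogonal C"
    using basis_orthogonal[OF B(1)] B(2) by auto
  \<comment> \<open>If 0 belongs to \<open>C\<close>, its coordinate functional is 0, since the inverse of 0 is 0.\<close>
  define coord where "coord b = blinfun_inner_left b /\<^sub>R (b \<bullet> b)" for b :: 'e
  have expand: "x = (\<Sum>b\<in>C. coord b x *\<^sub>R b)" for x
  proof -
    have "linear (\<lambda>x. \<Sum>b\<in>C. coord b x *\<^sub>R b)"
      by (intro linear_compose_sum ballI linearI)
        (simp_all add: blinfun.add_right blinfun.scaleR_right algebra_simps)
    moreover have "(\<Sum>b\<in>C. coord b c *\<^sub>R b) = c" if "c \<in> C" for c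
    proof -
      have "coord b c *\<^sub>R b = (if b = c then c else 0)" if "b \<in> C" for b
        using C(3) \<open>c \<in> C\<close> that
        by (cases "c = 0") (auto simp: coord_def pairwise_def orthogonal_def inner_commute blinfun.scaleR_left)
      then show ?thesis using C(1) that by (simp cong: sum.cong)
    qed
    moreover have "linear (\<lambda>x::'e. x)" by (rule linear_ident)
    ultimately show ?thesis
      using linear_eq_on_span[of "\<lambda>x. x" "\<lambda>x. \<Sum>b\<in>C. coord b x *\<^sub>R b" C x] C(2) by simp
  qed
  show ?thesis
  proof (rule ex1I)
    show "\<forall>\<nu>. \<Lambda> \<nu> = blinfun_apply \<nu> (\<Sum>b\<in>C. \<Lambda> (coord b) *\<^sub>R b)"
    proof
      fix \<nu> :: "'e dual"
      have "blinfun_apply \<nu> x = blinfun_apply (\<Sum>b\<in>C. blinfun_apply \<nu> b *\<^sub>R coord b) x" for x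
      proof -
        have "blinfun_apply \<nu> x = blinfun_apply \<nu> (\<Sum>b\<in>C. coord b x *\<^sub>R b)"
          using expand[of x] by simp
        then show ?thesis
          by (simp add: blinfun.sum_right blinfun.scaleR_right blinfun.sum_left blinfun.scaleR_left
              mult.commute)
      qed
      then have "\<nu> = (\<Sum>b\<in>C. blinfun_apply \<nu> b *\<^sub>R coord b)"
        by (rule blinfun_eqI)
      then have "\<Lambda> \<nu> = \<Lambda> (\<Sum>b\<in>C. blinfun_apply \<nu> b *\<^sub>R coord b)"
        by simp
      also have "\<dots> = (\<Sum>b\<in>C. blinfun_apply \<nu> b * \<Lambda> (coord b))"
        by (simp add: linear_sum[OF assms] linear_cmul[OF assms])
      finally show "\<Lambda> \<nu> = blinfun_apply \<nu> (\<Sum>b\<in>C. \<Lambda> (coord b) *\<^sub>R b)"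
        by (simp add: blinfun.sum_right blinfun.scaleR_right mult.commute)
    qed
    fix v assume v: "\<forall>\<nu>. \<Lambda> \<nu> = blinfun_apply \<nu> v"
    show "v = (\<Sum>b\<in>C. \<Lambda> (coord b) *\<^sub>R b)"
      using expand[of v] v by simp
  qed
qed

lemma partial_momentum:
  assumes "(\<lambda>\<rho>. h (g, \<rho>)) differentiable (at \<mu>)"
  shows "frechet_derivative (\<lambda>\<rho>. h (g, \<rho>)) (at \<mu>) \<nu> =
    blinfun_apply \<nu> (partial_momentum h (g, \<mu> :: 'e dual))"
  unfolding partial_momentum_def prod.case
  by (rule spec[OF theI'[OF bidual_representation[OF linear_frechet_derivative[OF assms]]]])

lemma has_derivative_hamiltonian:
  fixes h :: "'g \<times> 'e dual \<Rightarrow> real"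
  assumes h: "smooth_map_on (prod_atlas A vec_atlas) vec_atlas UNIV h"
    and s: "has_velocity A s g (left_trans G A g \<beta>)"
    and m: "m 0 = \<mu>" "(m has_vector_derivative \<nu>) (at 0)"
  shows "((\<lambda>t. h (s t, m t)) has_real_derivative
    left_cotrans G A g (partial_group A h (g, \<mu>)) \<beta> + blinfun_apply \<nu> (partial_momentum h (g, \<mu>))) (at 0)"
proof -
  note v = smooth_atlas_vec_atlas
  have h': "smooth_map_on (prod_atlas A vec_atlas) vec_atlas UNIV (\<lambda>(x, \<rho>). h (x, \<rho>))"
    using h by simp
  have mv: "has_velocity vec_atlas m \<mu> \<nu>"
    using m by (simp add: has_velocity_vec_atlas)
  have md: "manifold_differentiable vec_atlas vec_atlas (\<lambda>\<rho>. h (g, \<rho>)) \<mu>"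
    by (rule smooth_map_on_product_snd[OF atlas v v h'])
  then have d: "(\<lambda>\<rho>. h (g, \<rho>)) differentiable (at \<mu>)"
    by (simp add: manifold_differentiable_def o_def)
  have "((\<lambda>\<rho>. h (g, \<rho>)) has_derivative tangent_map vec_atlas vec_atlas (\<lambda>\<rho>. h (g, \<rho>)) \<mu>) (at \<mu>)"
    using blinfun_apply_tangent_map[OF md] by (simp add: o_def)
  then have "tangent_map vec_atlas vec_atlas (\<lambda>\<rho>. h (g, \<rho>)) \<mu> \<nu> =
      blinfun_apply \<nu> (partial_momentum h (g, \<mu>))"
    using frechet_derivative_at partial_momentum[of h, OF d] by metis
  then show ?thesis
    using has_velocity_product[OF atlas v v h' s mv]
    by (simp add: has_velocity_vec_atlas partial_group_def left_cotrans_def dual_map_def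
        has_real_derivative_iff_has_vector_derivative)
qed

end

section \<open>Discrete summation by parts\<close>

lemma sum_diff_shift:
  fixes P Q :: "nat \<Rightarrow> 'e::real_normed_vector dual"
  assumes "M \<ge> 1" "\<alpha> 0 = 0" "\<alpha> M = 0"
  shows "(\<Sum>k=1..M. P k (\<alpha> k) - Q k (\<alpha> (k - 1))) = (\<Sum>k=1..M-1. (P k - Q (k + 1)) (\<alpha> k))"
proof -
  obtain n where M: "M = Suc n"
    using assms(1) by (cases M) auto
  have "(\<Sum>k=1..M. Q k (\<alpha> (k - 1))) = (\<Sum>k=0..n. Q (Suc k) (\<alpha> k))"
    using sum.shift_bounds_cl_Suc_ivl[of "\<lambda>k. Q k (\<alpha> (k - 1))" 0 n] by (simp add: M)
  also have "\<dots> = (\<Sum>k=1..n. Q (Suc k) (\<alpha> k))"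
    using assms(2) by (simp add: sum.atLeast_Suc_atMost)
  finally show ?thesis
    using assms(3) by (simp add: M sum_subtractf blinfun.diff_left)
qed

text \<open>
  The fundamental lemma of the discrete calculus of variations: the interior variations \<open>\<alpha> k\<close> occur
  in two consecutive steps each, and all components of a variation are independent.
\<close>

lemma discrete_fundamental_lemma:
  fixes E P Q :: "nat \<Rightarrow> 'e::real_inner dual" and X Y :: "nat \<Rightarrow> 'e"
  assumes M: "M \<ge> 1"
  shows "(\<forall>\<alpha> \<beta> \<nu>1 \<nu>2. \<alpha> 0 = 0 \<and> \<alpha> M = 0 \<longrightarrow>
      (\<Sum>k=1..M. E k (\<beta> k) + (P k (\<alpha> k) - Q k (\<alpha> (k - 1)))
        + (blinfun_apply (\<nu>1 k) (X k) + blinfun_apply (\<nu>2 k) (Y k))) = 0) \<longleftrightarrow>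
    (\<forall>k\<in>{1..M}. E k = 0) \<and> (\<forall>k\<in>{1..M-1}. P k - Q (k + 1) = 0) \<and>
    (\<forall>k\<in>{1..M}. X k = 0 \<and> Y k = 0)" (is "?crit \<longleftrightarrow> ?eqs")
proof -
  have split: "(\<Sum>k=1..M. E k (\<beta> k) + (P k (\<alpha> k) - Q k (\<alpha> (k - 1)))
        + (blinfun_apply (\<nu>1 k) (X k) + blinfun_apply (\<nu>2 k) (Y k))) =
      (\<Sum>k=1..M. E k (\<beta> k)) + (\<Sum>k=1..M-1. (P k - Q (k + 1)) (\<alpha> k)) +
      ((\<Sum>k=1..M. blinfun_apply (\<nu>1 k) (X k)) + (\<Sum>k=1..M. blinfun_apply (\<nu>2 k) (Y k)))"
    if "\<alpha> 0 = 0" "\<alpha> M = 0" for \<alpha> \<beta> \<nu>1 \<nu>2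
    using sum_diff_shift[OF M that, of P Q] by (simp add: sum.distrib)
  show ?thesis
  proof
    assume eqs: ?eqs
    show ?crit
    proof (intro allI impI)
      fix \<alpha> \<beta> :: "nat \<Rightarrow> 'e" and \<nu>1 \<nu>2 :: "nat \<Rightarrow> 'e dual"
      assume "\<alpha> 0 = 0 \<and> \<alpha> M = 0"
      then have ends: "\<alpha> 0 = 0" "\<alpha> M = 0" by auto
      show "(\<Sum>k=1..M. E k (\<beta> k) + (P k (\<alpha> k) - Q k (\<alpha> (k - 1)))
        + (blinfun_apply (\<nu>1 k) (X k) + blinfun_apply (\<nu>2 k) (Y k))) = 0"
        unfolding split[OF ends] using eqs by simp
    qed
  next
    assume crit: ?crit
    have zero: "(\<Sum>k=1..M. E k (\<beta> k)) + (\<Sum>k=1..M-1. (P k - Q (k + 1)) (\<alpha> k)) +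
      ((\<Sum>k=1..M. blinfun_apply (\<nu>1 k) (X k)) + (\<Sum>k=1..M. blinfun_apply (\<nu>2 k) (Y k))) = 0"
      if "\<alpha> 0 = 0" "\<alpha> M = 0" for \<alpha> \<beta> \<nu>1 \<nu>2
      unfolding split[OF that, symmetric] by (rule crit[rule_format]) (use that in simp)
    \<comment> \<open>It suffices to test with variations that have a single nonzero component.\<close>
    have single: "(\<Sum>k\<in>S. blinfun_apply (F k) (if k = j then v else 0)) = F j v"
      if "j \<in> S" "finite S" for S and F :: "nat \<Rightarrow> 'e dual" and j v
    proof -
      have "(\<Sum>k\<in>S. blinfun_apply (F k) (if k = j then v else 0)) = (\<Sum>k\<in>S. if k = j then F j v else 0)"
        by (rule sum.cong) auto
      then show ?thesis using that by simp
    qed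
    have single': "(\<Sum>k\<in>S. blinfun_apply (if k = j then \<nu> else 0) (Z k)) = \<nu> (Z j)"
      if "j \<in> S" "finite S" for S and \<nu> :: "'e dual" and j Z
    proof -
      have "(\<Sum>k\<in>S. blinfun_apply (if k = j then \<nu> else 0) (Z k)) = (\<Sum>k\<in>S. if k = j then \<nu> (Z j) else 0)"
        by (rule sum.cong) auto
      then show ?thesis using that by simp
    qed
    have vanish: "x = 0" if "\<And>\<nu> :: 'e dual. blinfun_apply \<nu> x = 0" for x :: 'e
      using that[of "blinfun_inner_left x"] by simp
    have "E j = 0" if "j \<in> {1..M}" for j
    proof (rule blinfun_eqI)
      fix v
      show "E j v = blinfun_apply 0 v"
        using zero[of "\<lambda>_. 0" "\<lambda>k. if k = j then v else 0" "\<lambda>_. 0" "\<lambda>_. 0"] single[of j "{1..M}" E v] that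
        by simp
    qed
    moreover have "P j - Q (j + 1) = 0" if "j \<in> {1..M-1}" for j
    proof (rule blinfun_eqI)
      fix v
      have "M \<noteq> j" "j \<noteq> 0" using that M by auto
      then show "(P j - Q (j + 1)) v = blinfun_apply 0 v"
        using zero[of "\<lambda>k. if k = j then v else 0" "\<lambda>_. 0" "\<lambda>_. 0" "\<lambda>_. 0"]
          single[of j "{1..M-1}" "\<lambda>k. P k - Q (k + 1)" v] that
        by simp
    qed
    moreover have "X j = 0" if "j \<in> {1..M}" for j
    proof (rule vanish)
      fix \<nu> :: "'e dual"
      show "\<nu> (X j) = 0"
        using zero[of "\<lambda>_. 0" "\<lambda>_. 0" "\<lambda>k. if k = j then \<nu> else 0" "\<lambda>_. 0"] single'[of j "{1..M}" \<nu> X] that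
        by simp
    qed
    moreover have "Y j = 0" if "j \<in> {1..M}" for j
    proof (rule vanish)
      fix \<nu> :: "'e dual"
      show "\<nu> (Y j) = 0"
        using zero[of "\<lambda>_. 0" "\<lambda>_. 0" "\<lambda>_. 0" "\<lambda>k. if k = j then \<nu> else 0"] single'[of j "{1..M}" \<nu> Y] that
        by simp
    qed
    ultimately show ?eqs by blast
  qed
qed


section \<open>The differential of the discrete action\<close>

locale midpoint_action = lie_group G A
  for G :: "'g::{t2_space, second_countable_topology} monoid" (structure)
    and A :: "('g, 'e::real_inner) atlas" +
  fixes \<tau> :: "'e \<Rightarrow> 'g" and U :: "'e set"
    and h :: "'g \<times> 'e dual \<Rightarrow> real"
    and hs :: "nat \<Rightarrow> 'g \<times> 'e dual \<Rightarrow> real"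
    and N M :: nat and \<Delta>t :: real
    and \<Delta>W :: "nat \<Rightarrow> nat \<Rightarrow> real"
  assumes retraction: "lie_retraction G A \<tau> U"
    and smooth_h: "smooth_map_on (prod_atlas A vec_atlas) vec_atlas UNIV h"
    and smooth_hs: "\<And>i. i \<in> {1..N} \<Longrightarrow> smooth_map_on (prod_atlas A vec_atlas) vec_atlas UNIV (hs i)"
    and \<Delta>t_pos: "\<Delta>t > 0" and M_pos: "M \<ge> 1"
begin

abbreviation displacement1 :: "('g, 'e dual) discrete_curve \<Rightarrow> nat \<Rightarrow> 'e" where
  "displacement1 c k \<equiv> inv_into U \<tau> (step_elem1 G c k)"

abbreviation displacement2 :: "('g, 'e dual) discrete_curve \<Rightarrow> nat \<Rightarrow> 'e" where
  "displacement2 c k \<equiv> inv_into U \<tau> (step_elem2 G c k)"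

text \<open>
  A displacement \<open>\<zeta>\<close> with momentum \<open>\<mu>\<close> leads from a group element \<open>p\<close> to \<open>q = p \<tau>(\<zeta>)\<close>. The pairing of
  \<open>\<mu>\<close> with \<open>\<zeta>\<close> has, in left trivialization, the derivative \<open>final_momentum \<zeta> \<mu>\<close> with respect
  to \<open>q\<close> and \<open>- initial_momentum \<zeta> \<mu>\<close> with respect to \<open>p\<close>.
\<close>

definition initial_momentum :: "'e \<Rightarrow> 'e dual \<Rightarrow> 'e dual" where
  "initial_momentum \<zeta> \<mu> = dual_map (d_tau_inv G A \<tau> U \<zeta>) \<mu>"

definition final_momentum :: "'e \<Rightarrow> 'e dual \<Rightarrow> 'e dual" where
  "final_momentum \<zeta> \<mu> = coAd G A (\<tau> \<zeta>) (initial_momentum \<zeta> \<mu>)"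

definition force :: "('g, 'e dual) discrete_curve \<Rightarrow> nat \<Rightarrow> 'e dual" where
  "force c k = left_cotrans G A (stage c k) (partial_group A h (mid_state c k))
     + (\<Sum>i=1..N. (\<Delta>W i k / \<Delta>t) *\<^sub>R
          left_cotrans G A (stage c k) (partial_group A (hs i) (mid_state c k)))"

definition momentum_gradient :: "('g, 'e dual) discrete_curve \<Rightarrow> nat \<Rightarrow> 'e" where
  "momentum_gradient c k = partial_momentum h (mid_state c k)
     + (\<Sum>i=1..N. (\<Delta>W i k / \<Delta>t) *\<^sub>R partial_momentum (hs i) (mid_state c k))"

definition action_step :: "('g, 'e dual) discrete_curve \<Rightarrow> nat \<Rightarrow> real" where
  "action_step c k = blinfun_apply (mom2 c k) (displacement2 c k)
     + blinfun_apply (mom1 c k) (displacement1 c k)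
     - \<Delta>t * (h (mid_state c k) + (\<Sum>i=1..N. hs i (mid_state c k) * (\<Delta>W i k / \<Delta>t)))"

lemma discrete_action_eq_sum_action_step:
  "discrete_action G \<tau> U h N hs \<Delta>t M \<Delta>W c = (\<Sum>k=1..M. action_step c k)"
proof -
  have "(\<Sum>k=1..M. action_step c k) = (\<Sum>k<M. action_step c (Suc k))"
    by (simp add: sum.atLeast1_atMost_eq)
  then show ?thesis
    using \<Delta>t_pos
    by (simp add: discrete_action_def action_step_def blinfun.scaleR_right distrib_left right_diff_distrib
        diff_diff_eq mult.assoc[symmetric])
qed

text \<open>
  The factor \<open>\<Delta>t / 2\<close> comes from the midpoint of the momenta in \<^const>\<open>mid_state\<close>: each of the two
  momenta receives half of the gradient of the Hamiltonians.
\<close>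

lemma action_step_has_derivative:
  assumes elem: "step_elem1 G c k \<in> \<tau> ` U" "step_elem2 G c k \<in> \<tau> ` U"
    and node0: "has_velocity A (\<lambda>\<epsilon>. node (\<gamma> \<epsilon>) (k - 1)) (node c (k - 1)) (left_trans G A (node c (k - 1)) \<alpha>0)"
    and node1: "has_velocity A (\<lambda>\<epsilon>. node (\<gamma> \<epsilon>) k) (node c k) (left_trans G A (node c k) \<alpha>)"
    and stage: "has_velocity A (\<lambda>\<epsilon>. stage (\<gamma> \<epsilon>) k) (stage c k) (left_trans G A (stage c k) \<beta>)"
    and mom1: "has_velocity vec_atlas (\<lambda>\<epsilon>. mom1 (\<gamma> \<epsilon>) k) (mom1 c k) \<nu>1"
    and mom2: "has_velocity vec_atlas (\<lambda>\<epsilon>. mom2 (\<gamma> \<epsilon>) k) (mom2 c k) \<nu>2"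
  defines "\<zeta>1 \<equiv> displacement1 c k" and "\<zeta>2 \<equiv> displacement2 c k"
  shows "((\<lambda>\<epsilon>. action_step (\<gamma> \<epsilon>) k) has_real_derivative
      (final_momentum \<zeta>1 (mom1 c k) - initial_momentum \<zeta>2 (mom2 c k) - \<Delta>t *\<^sub>R force c k) \<beta>
      + (final_momentum \<zeta>2 (mom2 c k) \<alpha> - initial_momentum \<zeta>1 (mom1 c k) \<alpha>0)
      + (\<nu>1 (\<zeta>1 - (\<Delta>t / 2) *\<^sub>R momentum_gradient c k) + \<nu>2 (\<zeta>2 - (\<Delta>t / 2) *\<^sub>R momentum_gradient c k)))
    (at 0)"
proof -
  have d1: "((\<lambda>\<epsilon>. displacement1 (\<gamma> \<epsilon>) k) has_vector_derivative
      d_tau_inv G A \<tau> U \<zeta>1 (Ad G A (\<tau> \<zeta>1) \<beta> - \<alpha>0)) (at 0)"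
    using has_velocity_retraction_inverse[OF retraction _ node0 stage] elem(1)
    by (simp add: step_elem1_def \<zeta>1_def)
  have d2: "((\<lambda>\<epsilon>. displacement2 (\<gamma> \<epsilon>) k) has_vector_derivative
      d_tau_inv G A \<tau> U \<zeta>2 (Ad G A (\<tau> \<zeta>2) \<alpha> - \<beta>)) (at 0)"
    using has_velocity_retraction_inverse[OF retraction _ stage node1] elem(2)
    by (simp add: step_elem2_def \<zeta>2_def)
  have at0: "node (\<gamma> 0) (k - 1) = node c (k - 1)" "node (\<gamma> 0) k = node c k" "stage (\<gamma> 0) k = stage c k"
      "mom1 (\<gamma> 0) k = mom1 c k" "mom2 (\<gamma> 0) k = mom2 c k"
    using node0 node1 stage mom1 mom2 by (auto simp: has_velocity_def)
  have \<zeta>0: "displacement1 (\<gamma> 0) k = \<zeta>1" "displacement2 (\<gamma> 0) k = \<zeta>2"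
    by (simp_all only: at0 step_elem1_def step_elem2_def \<zeta>1_def \<zeta>2_def)
  have m1: "((\<lambda>\<epsilon>. mom1 (\<gamma> \<epsilon>) k) has_vector_derivative \<nu>1) (at 0)"
    and m2: "((\<lambda>\<epsilon>. mom2 (\<gamma> \<epsilon>) k) has_vector_derivative \<nu>2) (at 0)"
    using mom1 mom2 by (simp_all add: has_velocity_vec_atlas)
  note pair = bounded_bilinear.has_vector_derivative[OF bounded_bilinear_blinfun_apply]
  have p1: "((\<lambda>\<epsilon>. blinfun_apply (mom1 (\<gamma> \<epsilon>) k) (displacement1 (\<gamma> \<epsilon>) k)) has_real_derivative
      final_momentum \<zeta>1 (mom1 c k) \<beta> - initial_momentum \<zeta>1 (mom1 c k) \<alpha>0 + \<nu>1 \<zeta>1) (at 0)"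
    using pair[OF m1 d1] at0 \<zeta>0
    by (simp add: has_real_derivative_iff_has_vector_derivative final_momentum_def initial_momentum_def
        coAd_def dual_map_def blinfun.diff_right)
  have p2: "((\<lambda>\<epsilon>. blinfun_apply (mom2 (\<gamma> \<epsilon>) k) (displacement2 (\<gamma> \<epsilon>) k)) has_real_derivative
      final_momentum \<zeta>2 (mom2 c k) \<alpha> - initial_momentum \<zeta>2 (mom2 c k) \<beta> + \<nu>2 \<zeta>2) (at 0)"
    using pair[OF m2 d2] at0 \<zeta>0
    by (simp add: has_real_derivative_iff_has_vector_derivative final_momentum_def initial_momentum_def
        coAd_def dual_map_def blinfun.diff_right)
  let ?\<mu> = "(mom1 c k + mom2 c k) /\<^sub>R 2" and ?\<nu> = "(\<nu>1 + \<nu>2) /\<^sub>R 2"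
  have m: "((\<lambda>\<epsilon>. (mom1 (\<gamma> \<epsilon>) k + mom2 (\<gamma> \<epsilon>) k) /\<^sub>R 2) has_vector_derivative ?\<nu>) (at 0)"
    by (rule bounded_linear.has_vector_derivative[OF bounded_linear_scaleR_right
          has_vector_derivative_add[OF m1 m2]])
  have H: "((\<lambda>\<epsilon>. f (mid_state (\<gamma> \<epsilon>) k)) has_real_derivative
      left_cotrans G A (stage c k) (partial_group A f (mid_state c k)) \<beta>
      + blinfun_apply ?\<nu> (partial_momentum f (mid_state c k))) (at 0)"
    if "smooth_map_on (prod_atlas A vec_atlas) vec_atlas UNIV f" for f
    using has_derivative_hamiltonian[OF that stage _ m, of ?\<mu>] at0
    by (simp add: mid_state_def)
  have "((\<lambda>\<epsilon>. h (mid_state (\<gamma> \<epsilon>) k) + (\<Sum>i=1..N. hs i (mid_state (\<gamma> \<epsilon>) k) * (\<Delta>W i k / \<Delta>t)))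
      has_real_derivative
      left_cotrans G A (stage c k) (partial_group A h (mid_state c k)) \<beta>
      + blinfun_apply ?\<nu> (partial_momentum h (mid_state c k))
      + (\<Sum>i=1..N. (left_cotrans G A (stage c k) (partial_group A (hs i) (mid_state c k)) \<beta>
          + blinfun_apply ?\<nu> (partial_momentum (hs i) (mid_state c k))) * (\<Delta>W i k / \<Delta>t))) (at 0)"
    by (intro DERIV_add DERIV_sum DERIV_cmult_right H smooth_h smooth_hs)
  also have "left_cotrans G A (stage c k) (partial_group A h (mid_state c k)) \<beta>
      + blinfun_apply ?\<nu> (partial_momentum h (mid_state c k))
      + (\<Sum>i=1..N. (left_cotrans G A (stage c k) (partial_group A (hs i) (mid_state c k)) \<beta>
          + blinfun_apply ?\<nu> (partial_momentum (hs i) (mid_state c k))) * (\<Delta>W i k / \<Delta>t)) =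
      force c k \<beta> + blinfun_apply ?\<nu> (momentum_gradient c k)"
    by (simp add: force_def momentum_gradient_def blinfun.add_left blinfun.add_right blinfun.sum_left
        blinfun.sum_right blinfun.scaleR_left blinfun.scaleR_right sum.distrib[symmetric] algebra_simps
        cong: sum.cong)
  finally have gradients: "((\<lambda>\<epsilon>. h (mid_state (\<gamma> \<epsilon>) k)
      + (\<Sum>i=1..N. hs i (mid_state (\<gamma> \<epsilon>) k) * (\<Delta>W i k / \<Delta>t))) has_real_derivative
      force c k \<beta> + blinfun_apply ?\<nu> (momentum_gradient c k)) (at 0)" .
  have "((\<lambda>\<epsilon>. action_step (\<gamma> \<epsilon>) k) has_real_derivative
      (final_momentum \<zeta>2 (mom2 c k) \<alpha> - initial_momentum \<zeta>2 (mom2 c k) \<beta> + \<nu>2 \<zeta>2)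
      + (final_momentum \<zeta>1 (mom1 c k) \<beta> - initial_momentum \<zeta>1 (mom1 c k) \<alpha>0 + \<nu>1 \<zeta>1)
      - \<Delta>t * (force c k \<beta> + blinfun_apply ?\<nu> (momentum_gradient c k))) (at 0)"
    unfolding action_step_def by (rule DERIV_diff[OF DERIV_add[OF p2 p1] DERIV_cmult[OF gradients]])
  then show ?thesis
    by (rule DERIV_cong)
      (simp add: blinfun.diff_left blinfun.diff_right blinfun.add_left blinfun.scaleR_left
        blinfun.scaleR_right field_simps)
qed

lemma exists_variation_curve: "\<exists>\<gamma>. variation_curve A M \<gamma> c \<delta>"
proof -
  obtain x where x: "\<And>p v. tangent_curve A (x p v) p v"
    using exists_tangent_curve[OF atlas] by metis
  obtain y where y: "\<And>p v :: 'e dual. tangent_curve vec_atlas (y p v) p v"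
    using exists_tangent_curve[OF smooth_atlas_vec_atlas] by metis
  let ?\<gamma> = "\<lambda>\<epsilon>. \<lparr>node = \<lambda>k. x (node c k) (node \<delta> k) \<epsilon>, stage = \<lambda>k. x (stage c k) (stage \<delta> k) \<epsilon>,
    mom1 = \<lambda>k. y (mom1 c k) (mom1 \<delta> k) \<epsilon>, mom2 = \<lambda>k. y (mom2 c k) (mom2 \<delta> k) \<epsilon>\<rparr>"
  have "variation_curve A M ?\<gamma> c \<delta>"
    by (simp add: variation_curve_def x y)
  then show ?thesis by blast
qed

definition stage_residual :: "('g, 'e dual) discrete_curve \<Rightarrow> nat \<Rightarrow> 'e dual" where
  "stage_residual c k = final_momentum (displacement1 c k) (mom1 c k)
     - initial_momentum (displacement2 c k) (mom2 c k) - \<Delta>t *\<^sub>R force c k"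

text \<open>
  The arguments \<open>\<alpha>\<close> and \<open>\<beta>\<close> are the left-trivialized variations of the nodes and stages.
\<close>

definition action_differential ::
  "('g, 'e dual) discrete_curve \<Rightarrow> (nat \<Rightarrow> 'e) \<Rightarrow> (nat \<Rightarrow> 'e) \<Rightarrow> (nat \<Rightarrow> 'e dual) \<Rightarrow> (nat \<Rightarrow> 'e dual) \<Rightarrow> real"
where
  "action_differential c \<alpha> \<beta> \<nu>1 \<nu>2 = (\<Sum>k=1..M. stage_residual c k (\<beta> k)
     + (final_momentum (displacement2 c k) (mom2 c k) (\<alpha> k)
        - initial_momentum (displacement1 c k) (mom1 c k) (\<alpha> (k - 1)))
     + (blinfun_apply (\<nu>1 k) (displacement1 c k - (\<Delta>t / 2) *\<^sub>R momentum_gradient c k)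
        + blinfun_apply (\<nu>2 k) (displacement2 c k - (\<Delta>t / 2) *\<^sub>R momentum_gradient c k)))"

lemma has_differential_discrete_action:
  assumes elem: "\<And>k. k \<in> {1..M} \<Longrightarrow> step_elem1 G c k \<in> \<tau> ` U \<and> step_elem2 G c k \<in> \<tau> ` U"
    and node: "\<And>k. node \<delta> k = left_trans G A (node c k) (\<alpha> k)"
    and stage: "\<And>k. stage \<delta> k = left_trans G A (stage c k) (\<beta> k)"
  shows "has_differential A M (discrete_action G \<tau> U h N hs \<Delta>t M \<Delta>W) c \<delta> d \<longleftrightarrow>
    d = action_differential c \<alpha> \<beta> (mom1 \<delta>) (mom2 \<delta>)"
proof -
  have deriv: "((\<lambda>\<epsilon>. discrete_action G \<tau> U h N hs \<Delta>t M \<Delta>W (\<gamma> \<epsilon>)) has_real_derivative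
      action_differential c \<alpha> \<beta> (mom1 \<delta>) (mom2 \<delta>)) (at 0)" if \<gamma>: "variation_curve A M \<gamma> c \<delta>" for \<gamma>
  proof -
    have n: "has_velocity A (\<lambda>\<epsilon>. node (\<gamma> \<epsilon>) k) (node c k) (left_trans G A (node c k) (\<alpha> k))"
      if "k \<in> {0..M}" for k
      using \<gamma> that by (auto simp: variation_curve_def node[symmetric] intro!: tangent_curve_has_velocity)
    show ?thesis
      unfolding discrete_action_eq_sum_action_step action_differential_def stage_residual_def
    proof (intro DERIV_sum action_step_has_derivative n)
      fix k assume k: "k \<in> {1..M}"
      show "step_elem1 G c k \<in> \<tau> ` U" "step_elem2 G c k \<in> \<tau> ` U"
        using elem[OF k] by auto
      show "k - 1 \<in> {0..M}" "k \<in> {0..M}" using k by auto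
      show "has_velocity A (\<lambda>\<epsilon>. stage (\<gamma> \<epsilon>) k) (stage c k) (left_trans G A (stage c k) (\<beta> k))"
        "has_velocity vec_atlas (\<lambda>\<epsilon>. mom1 (\<gamma> \<epsilon>) k) (mom1 c k) (mom1 \<delta> k)"
        "has_velocity vec_atlas (\<lambda>\<epsilon>. mom2 (\<gamma> \<epsilon>) k) (mom2 c k) (mom2 \<delta> k)"
        using \<gamma> k by (auto simp: variation_curve_def stage[symmetric] intro!: tangent_curve_has_velocity)
    qed
  qed
  show ?thesis
    using deriv exists_variation_curve[of c \<delta>] unfolding has_differential_def
    by (metis DERIV_unique)
qed

text \<open>
  Left translation is onto every tangent space, so admissible variations and trivialized
  variations with \<open>\<alpha>\<close> vanishing at both ends are the same. A variation of zero has a trivialization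
  of zero, which transfers the end point condition.
\<close>

theorem critical_iff_midpoint_equations:
  assumes elem: "\<And>k. k \<in> {1..M} \<Longrightarrow> step_elem1 G c k \<in> \<tau> ` U \<and> step_elem2 G c k \<in> \<tau> ` U"
  shows "critical_fixed_endpoints A M (discrete_action G \<tau> U h N hs \<Delta>t M \<Delta>W) c \<longleftrightarrow>
    (\<forall>k\<in>{1..M}. stage_residual c k = 0) \<and>
    (\<forall>k\<in>{1..M-1}. final_momentum (displacement2 c k) (mom2 c k)
       - initial_momentum (displacement1 c (k + 1)) (mom1 c (k + 1)) = 0) \<and>
    (\<forall>k\<in>{1..M}. displacement1 c k - (\<Delta>t / 2) *\<^sub>R momentum_gradient c k = 0 \<and>
       displacement2 c k - (\<Delta>t / 2) *\<^sub>R momentum_gradient c k = 0)"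
    (is "?crit \<longleftrightarrow> ?eqs")
proof -
  have "?crit \<longleftrightarrow> (\<forall>\<alpha> \<beta> \<nu>1 \<nu>2. \<alpha> 0 = 0 \<and> \<alpha> M = 0 \<longrightarrow> action_differential c \<alpha> \<beta> \<nu>1 \<nu>2 = 0)"
    (is "_ \<longleftrightarrow> ?vanish")
  proof
    assume crit: ?crit
    show ?vanish
    proof (intro allI impI)
      fix \<alpha> \<beta> :: "nat \<Rightarrow> 'e" and \<nu>1 \<nu>2 :: "nat \<Rightarrow> 'e dual"
      assume ends: "\<alpha> 0 = 0 \<and> \<alpha> M = 0"
      let ?\<delta> = "\<lparr>node = \<lambda>k. left_trans G A (node c k) (\<alpha> k),
        stage = \<lambda>k. left_trans G A (stage c k) (\<beta> k), mom1 = \<nu>1, mom2 = \<nu>2\<rparr>"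
      have "has_differential A M (discrete_action G \<tau> U h N hs \<Delta>t M \<Delta>W) c ?\<delta> 0"
        using crit ends by (simp add: critical_fixed_endpoints_def)
      then show "action_differential c \<alpha> \<beta> \<nu>1 \<nu>2 = 0"
        using has_differential_discrete_action[OF elem, of ?\<delta> \<alpha> \<beta> 0] by simp
    qed
  next
    assume vanish: ?vanish
    show ?crit
      unfolding critical_fixed_endpoints_def
    proof (intro allI impI)
      fix \<delta> :: "('e, 'e dual) discrete_curve"
      assume ends: "node \<delta> 0 = 0 \<and> node \<delta> M = 0"
      let ?\<alpha> = "\<lambda>k. left_log_deriv (node c k) (node \<delta> k)"
        and ?\<beta> = "\<lambda>k. left_log_deriv (stage c k) (stage \<delta> k)"
      have "action_differential c ?\<alpha> ?\<beta> (mom1 \<delta>) (mom2 \<delta>) = 0"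
        using vanish ends by simp
      then show "has_differential A M (discrete_action G \<tau> U h N hs \<Delta>t M \<Delta>W) c \<delta> 0"
        using has_differential_discrete_action[OF elem, of \<delta> ?\<alpha> ?\<beta> 0]
        by (simp add: left_trans_left_log_deriv)
    qed
  qed
  also have "\<dots> \<longleftrightarrow> ?eqs"
    unfolding action_differential_def by (rule discrete_fundamental_lemma[OF M_pos])
  finally show ?thesis .
qed

end
section \<open>The stochastic midpoint equations\<close>

text \<open>
  What is left is to express the displacements by \<open>\<Delta>t\<close> times \<open>\<xi>\<close> and \<open>\<xi>'\<close>, and to divide by the
  nonzero number \<open>\<Delta>t\<close>.
\<close>

theorem proposition3p1:
  fixes G :: "'g::{t2_space, second_countable_topology} monoid"
    and A :: "('g, 'e::real_inner) atlas"
    and \<tau> :: "'e \<Rightarrow> 'g" and U :: "'e set"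
    and h :: "'g \<times> 'e dual \<Rightarrow> real"
    and hs :: "nat \<Rightarrow> 'g \<times> 'e dual \<Rightarrow> real"
    and N M :: nat and \<Delta>t :: real
    and P :: "'w measure" and W :: "nat \<Rightarrow> real \<Rightarrow> 'w \<Rightarrow> real" and \<omega> :: 'w
    and \<Delta>W :: "nat \<Rightarrow> nat \<Rightarrow> real"
    and c :: "('g, 'e dual) discrete_curve"
    and \<xi> \<xi>' :: "nat \<Rightarrow> 'e"
  assumes "lie_group G A"
    and "lie_retraction G A \<tau> U"
    and "smooth_map_on (prod_atlas A vec_atlas) vec_atlas UNIV h"
    and "\<And>i. i \<in> {1..N} \<Longrightarrow> smooth_map_on (prod_atlas A vec_atlas) vec_atlas UNIV (hs i)"
    and "\<Delta>t > 0" and "M \<ge> 1"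
    and "independent_wiener_processes P N W" and "\<omega> \<in> space P"
    and "\<Delta>W = wiener_increment W \<Delta>t \<omega>"
    and "\<And>k. k \<in> {1..M} \<Longrightarrow> step_elem1 G c k \<in> \<tau> ` U \<and> step_elem2 G c k \<in> \<tau> ` U"
    and "\<And>k. k \<in> {1..M} \<Longrightarrow> \<Delta>t *\<^sub>R \<xi> k = inv_into U \<tau> (step_elem2 G c k)"
    and "\<And>k. k \<in> {1..M} \<Longrightarrow> \<Delta>t *\<^sub>R \<xi>' k = inv_into U \<tau> (step_elem1 G c k)"
  shows "critical_fixed_endpoints A M (discrete_action G \<tau> U h N hs \<Delta>t M \<Delta>W) c \<longleftrightarrow>
    (\<forall>k\<in>{1..M}.
       (coAd G A (\<tau> (\<Delta>t *\<^sub>R \<xi>' k)) (dual_map (d_tau_inv G A \<tau> U (\<Delta>t *\<^sub>R \<xi>' k)) (mom1 c k))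
        - dual_map (d_tau_inv G A \<tau> U (\<Delta>t *\<^sub>R \<xi> k)) (mom2 c k)) /\<^sub>R \<Delta>t
       = left_cotrans G A (stage c k) (partial_group A h (mid_state c k))
         + (\<Sum>i=1..N. (\<Delta>W i k / \<Delta>t) *\<^sub>R
              left_cotrans G A (stage c k) (partial_group A (hs i) (mid_state c k)))) \<and>
    (\<forall>k\<in>{1..M-1}.
       (coAd G A (\<tau> (\<Delta>t *\<^sub>R \<xi> k)) (dual_map (d_tau_inv G A \<tau> U (\<Delta>t *\<^sub>R \<xi> k)) (mom2 c k))
        - dual_map (d_tau_inv G A \<tau> U (\<Delta>t *\<^sub>R \<xi>' (k + 1))) (mom1 c (k + 1))) /\<^sub>R \<Delta>t
       = 0) \<and>
    (\<forall>k\<in>{1..M}.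
       \<xi>' k = (1/2) *\<^sub>R partial_momentum h (mid_state c k)
              + (1/2) *\<^sub>R (\<Sum>i=1..N. (\<Delta>W i k / \<Delta>t) *\<^sub>R partial_momentum (hs i) (mid_state c k)) \<and>
       \<xi> k = (1/2) *\<^sub>R partial_momentum h (mid_state c k)
             + (1/2) *\<^sub>R (\<Sum>i=1..N. (\<Delta>W i k / \<Delta>t) *\<^sub>R partial_momentum (hs i) (mid_state c k)))"
proof -
  interpret midpoint_action G A \<tau> U h hs N M \<Delta>t \<Delta>W
    using assms(1-6) by (intro midpoint_action.intro midpoint_action_axioms.intro)
  have half: "x - (\<Delta>t / 2) *\<^sub>R (a + b) = 0 \<longleftrightarrow> y = (1/2) *\<^sub>R a + (1/2) *\<^sub>R b"
    if "\<Delta>t *\<^sub>R y = x" for x y a b :: 'e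
  proof -
    have "x - (\<Delta>t / 2) *\<^sub>R (a + b) = \<Delta>t *\<^sub>R (y - ((1/2) *\<^sub>R a + (1/2) *\<^sub>R b))"
      using that by (simp add: algebra_simps)
    then show ?thesis using \<open>\<Delta>t > 0\<close> by simp
  qed
  have quotient: "x - \<Delta>t *\<^sub>R y = 0 \<longleftrightarrow> x /\<^sub>R \<Delta>t = y" for x y :: "'e dual"
  proof -
    have "x - \<Delta>t *\<^sub>R y = \<Delta>t *\<^sub>R (x /\<^sub>R \<Delta>t - y)"
      using \<open>\<Delta>t > 0\<close> by (simp add: algebra_simps)
    then show ?thesis using \<open>\<Delta>t > 0\<close> by simp
  qed
  have stages: "(\<forall>k\<in>{1..M}. stage_residual c k = 0) \<longleftrightarrow> (\<forall>k\<in>{1..M}.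
       (coAd G A (\<tau> (\<Delta>t *\<^sub>R \<xi>' k)) (dual_map (d_tau_inv G A \<tau> U (\<Delta>t *\<^sub>R \<xi>' k)) (mom1 c k))
        - dual_map (d_tau_inv G A \<tau> U (\<Delta>t *\<^sub>R \<xi> k)) (mom2 c k)) /\<^sub>R \<Delta>t
       = left_cotrans G A (stage c k) (partial_group A h (mid_state c k))
         + (\<Sum>i=1..N. (\<Delta>W i k / \<Delta>t) *\<^sub>R
              left_cotrans G A (stage c k) (partial_group A (hs i) (mid_state c k))))"
    unfolding stage_residual_def quotient force_def final_momentum_def initial_momentum_def
    by (intro ball_cong refl) (simp only: assms(11,12))
  have nodes: "(\<forall>k\<in>{1..M-1}. final_momentum (displacement2 c k) (mom2 c k)
       - initial_momentum (displacement1 c (k + 1)) (mom1 c (k + 1)) = 0) \<longleftrightarrow> (\<forall>k\<in>{1..M-1}.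
       (coAd G A (\<tau> (\<Delta>t *\<^sub>R \<xi> k)) (dual_map (d_tau_inv G A \<tau> U (\<Delta>t *\<^sub>R \<xi> k)) (mom2 c k))
        - dual_map (d_tau_inv G A \<tau> U (\<Delta>t *\<^sub>R \<xi>' (k + 1))) (mom1 c (k + 1))) /\<^sub>R \<Delta>t
       = 0)"
  proof (intro ball_cong refl)
    fix k assume "k \<in> {1..M-1}"
    then have k: "k \<in> {1..M}" "k + 1 \<in> {1..M}" by auto
    show "(final_momentum (displacement2 c k) (mom2 c k)
       - initial_momentum (displacement1 c (k + 1)) (mom1 c (k + 1)) = 0) \<longleftrightarrow>
       ((coAd G A (\<tau> (\<Delta>t *\<^sub>R \<xi> k)) (dual_map (d_tau_inv G A \<tau> U (\<Delta>t *\<^sub>R \<xi> k)) (mom2 c k))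
        - dual_map (d_tau_inv G A \<tau> U (\<Delta>t *\<^sub>R \<xi>' (k + 1))) (mom1 c (k + 1))) /\<^sub>R \<Delta>t
       = 0)"
      using \<open>\<Delta>t > 0\<close>
      unfolding final_momentum_def initial_momentum_def assms(11)[OF k(1)] assms(12)[OF k(2)] by simp
  qed
  have momenta: "(\<forall>k\<in>{1..M}. displacement1 c k - (\<Delta>t / 2) *\<^sub>R momentum_gradient c k = 0 \<and>
       displacement2 c k - (\<Delta>t / 2) *\<^sub>R momentum_gradient c k = 0) \<longleftrightarrow> (\<forall>k\<in>{1..M}.
       \<xi>' k = (1/2) *\<^sub>R partial_momentum h (mid_state c k)
              + (1/2) *\<^sub>R (\<Sum>i=1..N. (\<Delta>W i k / \<Delta>t) *\<^sub>R partial_momentum (hs i) (mid_state c k)) \<and>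
       \<xi> k = (1/2) *\<^sub>R partial_momentum h (mid_state c k)
             + (1/2) *\<^sub>R (\<Sum>i=1..N. (\<Delta>W i k / \<Delta>t) *\<^sub>R partial_momentum (hs i) (mid_state c k)))"
    unfolding momentum_gradient_def
    by (intro ball_cong refl arg_cong2[where f = "(\<and>)"] half assms(11,12))
  show ?thesis
    by (rule trans[OF critical_iff_midpoint_equations[OF assms(10)]
          arg_cong2[where f = "(\<and>)", OF stages arg_cong2[where f = "(\<and>)", OF nodes momenta]]])
qed

end
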